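(* Let $d\ge1$ and $U=U(S_{\rm lazy},\mathcal{P}_{\rm lazy},G_{2d+1})$ acting on $\ell^2(\mathbb{Z}^d,\mathbb{C}^{2d+1})$. Then $1$ is an eigenvalue of $U$ and $U$ has no other eigenvalues. If $\Pi_+$ denotes the orthogonal projection onto the eigenspace of $U$ for eigenvalue $1$, then for every $\phi\in\mathbb{C}^{2d+1}$ and $x\in\mathbb{Z}^d$, $$\lim_{n\to\infty}p_n(\phi;x)=\|\Pi_+(\delta_0\otimes\phi)(x)\|^2_{\mathbb{C}^{2d+1}}.$$
   Context: Let $u_1,\dots,u_d$ be the standard basis of $\mathbb{Z}^d$, $\mathbf{e}_1,\dots,\mathbf{e}_{2d+1}$ the standard basis of $\mathbb{C}^{2d+1}$, $P_j$ the orthogonal projection onto $\mathbb{C}\mathbf{e}_j$. $S_{\rm lazy}=\{0,\pm u_1,\dots,\pm u_d\}$ and $\mathcal{P}_{\rm lazy}=\{P_\alpha\}_{\alpha\in S_{\rm lazy}}$ with $P_{u_j}=P_j$, $P_0=P_{d+1}$, $P_{-u_j}=P_{d+1+j}$ ($j=1,\dots,d$). For $\alpha\in\mathbb{Z}^d$, $(\tau^\alpha f)(x)=f(x-\alpha)$. For a unitary matrix $C$ acting pointwise, $U(S_{\rm lazy},\mathcal{P}_{\rm lazy},C)=\big(\sum_{\alpha\in S_{\rm lazy}}\tau^\alpha P_\alpha\big)C$. $G_D=\frac2DJ-I$ with $J$ the all-ones $D\times D$ matrix. $\delta_0\otimes\phi$ equals $\phi$ at $0$ and $0$ elsewhere,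 and $p_n(\phi;x)=\|U^n(\delta_0\otimes\phi)(x)\|^2$. *)

theory Defs
  imports "HOL-Analysis.Analysis"
begin

text \<open>Lattice points of Z^d are functions nat => int vanishing at indices >= d.
  Coin vectors in C^D are functions nat => complex vanishing at indices >= D;
  basis vector e_(j+1) of the paper corresponds to index j (0-based).\<close>

definition lat :: "nat \<Rightarrow> (nat \<Rightarrow> int) set" where
  "lat d = {x. \<forall>i\<ge>d. x i = 0}"

definition unit_vec :: "nat \<Rightarrow> nat \<Rightarrow> int" where
  "unit_vec i = (\<lambda>k. if k = i then 1 else 0)"

definition coinnorm2 :: "nat \<Rightarrow> (nat \<Rightarrow> complex) \<Rightarrow> real" where
  "coinnorm2 D \<phi> = (\<Sum>j<D. (cmod (\<phi> j))\<^sup>2)"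

definition l2 :: "nat \<Rightarrow> ((nat \<Rightarrow> int) \<Rightarrow> nat \<Rightarrow> complex) set" where
  "l2 d = {\<psi>. (\<forall>x j. (x \<notin> lat d \<or> 2*d+1 \<le> j) \<longrightarrow> \<psi> x j = 0)
              \<and> (\<lambda>x. coinnorm2 (2*d+1) (\<psi> x)) summable_on lat d}"

definition l2_inner :: "nat \<Rightarrow> ((nat \<Rightarrow> int) \<Rightarrow> nat \<Rightarrow> complex)
     \<Rightarrow> ((nat \<Rightarrow> int) \<Rightarrow> nat \<Rightarrow> complex) \<Rightarrow> complex" where
  "l2_inner d \<psi> c = infsum (\<lambda>x. \<Sum>j<2*d+1. \<psi> x j * cnj (c x j)) (lat d)"

definition grover :: "nat \<Rightarrow> (nat \<Rightarrow> complex) \<Rightarrow> nat \<Rightarrow> complex" where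
  "grover D \<phi> = (\<lambda>j. if j < D then (2 / of_nat D) * (\<Sum>i<D. \<phi> i) - \<phi> j else 0)"

text \<open>Shift alpha attached to coin index j (0-based): P_(u_(j+1)) for j<d,
  P_0 for j=d, P_(-u_(k+1)) for j=d+1+k.\<close>
definition shift_of :: "nat \<Rightarrow> nat \<Rightarrow> nat \<Rightarrow> int" where
  "shift_of d j = (if j < d then unit_vec j
                   else if j = d then (\<lambda>_. 0)
                   else if j < 2*d+1 then (\<lambda>k. - unit_vec (j - d - 1) k) else (\<lambda>_. 0))"

text \<open>U(S_lazy, P_lazy, G_(2d+1)) = (sum_alpha tau^alpha P_alpha) G:
  (U psi)(x)_j = (G psi(x - alpha_j))_j.\<close>
definition U_lazy :: "nat \<Rightarrow> ((nat \<Rightarrow> int) \<Rightarrow> nat \<Rightarrow> complex) \<Rightarrow> (nat \<Rightarrow> int) \<Rightarrow> nat \<Rightarrow> complex" where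
  "U_lazy d \<psi> = (\<lambda>x j. if x \<in> lat d \<and> j < 2*d+1
                        then grover (2*d+1) (\<psi> (\<lambda>i. x i - shift_of d j i)) j else 0)"

definition is_eigenvalue :: "nat \<Rightarrow> complex \<Rightarrow> bool" where
  "is_eigenvalue d mu \<longleftrightarrow> (\<exists>\<psi>\<in>l2 d. \<psi> \<noteq> (\<lambda>_ _. 0) \<and> U_lazy d \<psi> = (\<lambda>x j. mu * \<psi> x j))"

definition eigenspace1 :: "nat \<Rightarrow> ((nat \<Rightarrow> int) \<Rightarrow> nat \<Rightarrow> complex) set" where
  "eigenspace1 d = {\<psi> \<in> l2 d. U_lazy d \<psi> = \<psi>}"

definition proj_plus :: "nat \<Rightarrow> ((nat \<Rightarrow> int) \<Rightarrow> nat \<Rightarrow> complex) \<Rightarrow> (nat \<Rightarrow> int) \<Rightarrow> nat \<Rightarrow> complex" where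
  "proj_plus d c = (THE p. p \<in> eigenspace1 d \<and> (\<forall>\<psi>\<in>eigenspace1 d. l2_inner d (\<lambda>x j. c x j - p x j) \<psi> = 0))"

definition delta0 :: "(nat \<Rightarrow> complex) \<Rightarrow> (nat \<Rightarrow> int) \<Rightarrow> nat \<Rightarrow> complex" where
  "delta0 \<phi> = (\<lambda>x j. if x = (\<lambda>_. 0) then \<phi> j else 0)"

definition p_n :: "nat \<Rightarrow> nat \<Rightarrow> (nat \<Rightarrow> complex) \<Rightarrow> (nat \<Rightarrow> int) \<Rightarrow> real" where
  "p_n d n \<phi> x = coinnorm2 (2*d+1) ((U_lazy d ^^ n) (delta0 \<phi>) x)"

end

(* Write U for the walk, z_i for translation by the i-th unit vector and X for multiplication by the
last coordinate of position; U and the z_i commute. The characteristic polynomial R of the fibres of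
U, viewed as a Laurent polynomial in U and the z_i, vanishes on the Hilbert space. Commuting this
identity with X gives 0 = [X, R]; conjugating with powers of U, summing, and using that
[X, U^n] = sum_k U^k [X, U] U^(n-1-k) has bounded matrix entries in n, one sees that n U^n Q f stays
coordinatewise bounded, where Q is the derivative of R in the momentum of the last direction. So
U^n Q f tends weakly to 0 for f in the domain of X. Since R is linear in z + 1/z for the last
direction, Q is a product of factors that are injective on square-summable functions, except for
U - 1: all the others are ruled out by the fact that a nonzero square-summable function is not
invariant under a nontrivial translation. Hence ker Q* = ker Q = ker (U - 1), the range of Q is dense
in the orthogonal complement of ker (U - 1), and U^n converges weakly to the projection onto
ker (U - 1). In particular mu^n converges for every eigenvalue mu, which forces mu = 1. *)

theory Submission
  imports Defs
begin

section \<open>The Hilbert space of square-summable functions\<close>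


text \<open>The identity R = 0 needs no Fourier transform, but its shape comes from one. Write D =
  2d+1 and s for the sum of the coin coordinates. On a fibre, an eigenvector satisfies (U + z_j) f_j
  = (2/D) z_j s, where z_j is the shift of coin index j. Summing over j gives the secular equation
  (2/D) \<Sum> z_j / (U + z_j) = 1. A pair of opposite shifts z, 1/z contributes 1 - (U - 1/U) / b
  with b = U + 1/U + z + 1/z, and the zero shift contributes 1 / (U + 1). Clearing denominators
  leaves (U - 1) (N + 2 u S) = 0, where N is the product of the b_i, S is the sum of the products
  omitting one b_i, and u = (U + 1)^2 / U. The same computation is done below with operators acting
  on coordinates.

  The obstacle to decay is that [X, U] does not commute with U. It is only after summing conjugates
  that the commutators telescope to [X, U^n], whereas Q, which does commute with U, picks up the
  factor n.\<close>

typedef 'a ell2 = "{f :: 'a \<Rightarrow> complex. (\<lambda>a. (cmod (f a))\<^sup>2) summable_on UNIV}"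
  morphisms coord Ell2
  by (rule exI[of _ "\<lambda>_. 0"]) simp

setup_lifting type_definition_ell2

lemma square_summable_add:
  assumes "(\<lambda>a. (cmod (f a))\<^sup>2) summable_on A" "(\<lambda>a. (cmod (g a))\<^sup>2) summable_on A"
  shows "(\<lambda>a. (cmod (f a + g a))\<^sup>2) summable_on A"
proof (rule summable_on_comparison_test)
  show "(\<lambda>a. 2 * (cmod (f a))\<^sup>2 + 2 * (cmod (g a))\<^sup>2) summable_on A"
    using assms by (intro summable_on_add summable_on_cmult_right)
  fix a
  have "(cmod (f a + g a))\<^sup>2 \<le> (cmod (f a) + cmod (g a))\<^sup>2"
    by (intro power_mono norm_triangle_ineq) auto
  also have "\<dots> \<le> 2 * (cmod (f a))\<^sup>2 + 2 * (cmod (g a))\<^sup>2"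
    using sum_squares_bound[of "cmod (f a)" "cmod (g a)"] by (simp add: power2_sum)
  finally show "(cmod (f a + g a))\<^sup>2 \<le> 2 * (cmod (f a))\<^sup>2 + 2 * (cmod (g a))\<^sup>2" .
qed auto

lemma square_summable_product:
  assumes "(\<lambda>a. (cmod (f a))\<^sup>2) summable_on A" "(\<lambda>a. (cmod (g a))\<^sup>2) summable_on A"
  shows "(\<lambda>a. f a * cnj (g a)) summable_on A"
  by (rule abs_summable_summable[OF abs_summable_product])
    (use assms in \<open>simp_all add: norm_mult power2_eq_square\<close>)

instantiation ell2 :: (type) real_vector
begin

lift_definition zero_ell2 :: "'a ell2" is "\<lambda>_. 0" by simp

lift_definition plus_ell2 :: "'a ell2 \<Rightarrow> 'a ell2 \<Rightarrow> 'a ell2" is "\<lambda>f g a. f a + g a"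
  using square_summable_add by blast

lift_definition uminus_ell2 :: "'a ell2 \<Rightarrow> 'a ell2" is "\<lambda>f a. - f a"
  by simp

lift_definition minus_ell2 :: "'a ell2 \<Rightarrow> 'a ell2 \<Rightarrow> 'a ell2" is "\<lambda>f g a. f a - g a"
  using square_summable_add[of _ UNIV "\<lambda>a. - _ a"] by simp

lift_definition scaleR_ell2 :: "real \<Rightarrow> 'a ell2 \<Rightarrow> 'a ell2" is "\<lambda>r f a. of_real r * f a"
  by (simp add: norm_mult power_mult_distrib summable_on_cmult_right)

instance
  by standard (transfer; auto simp: algebra_simps)+

end

text \<open>The inner product is the real part of the complex one, since the class knows only real
  scalars. Complex orthogonality is recovered later by testing against \<open>times_i\<close> as
  well.\<close>

instantiation ell2 :: (type) real_inner
begin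

definition inner_ell2 :: "'a ell2 \<Rightarrow> 'a ell2 \<Rightarrow> real" where
  "inner_ell2 f g = (\<Sum>\<^sub>\<infinity>a. Re (coord f a * cnj (coord g a)))"

definition norm_ell2 :: "'a ell2 \<Rightarrow> real" where
  "norm_ell2 f = sqrt (inner f f)"

definition dist_ell2 :: "'a ell2 \<Rightarrow> 'a ell2 \<Rightarrow> real" where
  "dist_ell2 f g = norm (f - g)"

definition sgn_ell2 :: "'a ell2 \<Rightarrow> 'a ell2" where
  "sgn_ell2 f = f /\<^sub>R norm f"

definition uniformity_ell2 :: "('a ell2 \<times> 'a ell2) filter" where
  "uniformity_ell2 = (INF e\<in>{0<..}. principal {(x, y). dist x y < e})"

definition open_ell2 :: "'a ell2 set \<Rightarrow> bool" where
  "open_ell2 U \<longleftrightarrow> (\<forall>x\<in>U. \<forall>\<^sub>F (x', y) in uniformity. x' = x \<longrightarrow> y \<in> U)"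

instance
proof
  fix f g h :: "'a ell2" and r s :: real
  have sq: "(\<lambda>a. (cmod (coord f a))\<^sup>2) summable_on UNIV" for f :: "'a ell2"
    using coord[of f] by simp
  have summ: "(\<lambda>a. Re (coord f a * cnj (coord g a))) summable_on UNIV" for f g :: "'a ell2"
    by (intro summable_on_Re square_summable_product sq)
  show "inner f g = inner g f"
    by (simp add: inner_ell2_def mult.commute)
  show "inner (f + g) h = inner f h + inner g h"
    unfolding inner_ell2_def
    by (subst infsum_add[OF summ summ, symmetric])
      (simp add: plus_ell2.rep_eq algebra_simps)
  show "inner (r *\<^sub>R f) g = r * inner f g"
    unfolding inner_ell2_def infsum_cmult_right'[symmetric]
    by (simp add: scaleR_ell2.rep_eq algebra_simps)
  show "inner f f \<ge> 0"
    unfolding inner_ell2_def by (intro infsum_nonneg) (simp add: complex_mult_cnj)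
  show "inner f f = 0 \<longleftrightarrow> f = 0"
  proof
    assume "inner f f = 0"
    then have "Re (coord f a * cnj (coord f a)) = 0" for a
      by (intro nonneg_infsum_le_0D[of "\<lambda>a. Re (coord f a * cnj (coord f a))" UNIV] summ)
        (auto simp: inner_ell2_def)
    then have "coord f a = 0" for a
      by (simp add: complex_eq_iff sum_squares_eq_zero_iff)
    then show "f = 0"
      by (transfer) auto
  next
    assume "f = 0"
    then show "inner f f = 0"
      by (simp add: inner_ell2_def zero_ell2.rep_eq)
  qed
qed (auto simp: norm_ell2_def dist_ell2_def sgn_ell2_def uniformity_ell2_def open_ell2_def)

end

lemmas coord_simps [simp] =
  zero_ell2.rep_eq plus_ell2.rep_eq minus_ell2.rep_eq uminus_ell2.rep_eq scaleR_ell2.rep_eq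

lemma ell2_eqI: "(\<And>a. coord f a = coord g a) \<Longrightarrow> f = g"
  by (metis coord_inject ext)

lemma square_summable_coord: "(\<lambda>a. (cmod (coord f a))\<^sup>2) summable_on UNIV"
  using coord[of f] by simp

lemma summable_inner_ell2: "(\<lambda>a. coord f a * cnj (coord g a)) summable_on UNIV"
  by (intro square_summable_product square_summable_coord)

lemma inner_ell2_eq_Re: "inner f g = Re (\<Sum>\<^sub>\<infinity>a. coord f a * cnj (coord g a))"
  unfolding inner_ell2_def by (rule infsum_Re[OF summable_inner_ell2])

lemma norm_ell2_square: "(norm f)\<^sup>2 = (\<Sum>\<^sub>\<infinity>a. (cmod (coord f a))\<^sup>2)"
  unfolding power2_norm_eq_inner[of f] inner_ell2_def
  by (intro infsum_cong) (simp add: cmod_power2 flip: power2_eq_square)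

lemma sum_coord_le: "finite A \<Longrightarrow> (\<Sum>a\<in>A. (cmod (coord f a))\<^sup>2) \<le> (norm f)\<^sup>2"
  unfolding norm_ell2_square
  by (intro finite_sum_le_infsum square_summable_coord) auto

lemma cmod_coord_le: "cmod (coord f a) \<le> norm f"
  using sum_coord_le[of "{a}" f] by (simp add: power2_le_iff_abs_le)

text \<open>The candidate is the pointwise limit. Bounds on partial sums that are uniform over
  finite sets survive pointwise limits; they give both its square-summability and convergence in
  norm.\<close>

instance ell2 :: (type) complete_space
proof
  fix F :: "nat \<Rightarrow> 'a ell2"
  assume "Cauchy F"
  have Cauchy_coord: "Cauchy (\<lambda>n. coord (F n) a)" for a
  proof (rule metric_CauchyI)
    fix e :: real assume "e > 0"
    with \<open>Cauchy F\<close> obtain M where "\<forall>m\<ge>M. \<forall>n\<ge>M. dist (F m) (F n) < e"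
      by (metis metric_CauchyD)
    moreover have "dist (coord (F m) a) (coord (F n) a) \<le> dist (F m) (F n)" for m n
      using cmod_coord_le[of "F m - F n" a] by (simp add: dist_norm)
    ultimately show "\<exists>M. \<forall>m\<ge>M. \<forall>n\<ge>M. dist (coord (F m) a) (coord (F n) a) < e"
      by (meson le_less_trans)
  qed
  define f where "f a = lim (\<lambda>n. coord (F n) a)" for a
  have f: "(\<lambda>n. coord (F n) a) \<longlonglongrightarrow> f a" for a
    using Cauchy_coord[of a]
    by (simp add: f_def Cauchy_convergent_iff convergent_LIMSEQ_iff)
  have bound: "\<exists>N. \<forall>n\<ge>N. \<forall>A. finite A \<longrightarrow> (\<Sum>a\<in>A. (cmod (coord (F n) a - f a))\<^sup>2) \<le> e\<^sup>2"
    if "e > 0" for e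
  proof -
    from \<open>Cauchy F\<close> that obtain N where N: "\<forall>m\<ge>N. \<forall>n\<ge>N. dist (F m) (F n) < e"
      by (metis metric_CauchyD)
    have "(\<Sum>a\<in>A. (cmod (coord (F n) a - f a))\<^sup>2) \<le> e\<^sup>2" if "n \<ge> N" "finite A" for n A
    proof (rule LIMSEQ_le_const2)
      show "(\<lambda>m. \<Sum>a\<in>A. (cmod (coord (F n) a - coord (F m) a))\<^sup>2)
          \<longlonglongrightarrow> (\<Sum>a\<in>A. (cmod (coord (F n) a - f a))\<^sup>2)"
        by (intro tendsto_intros f)
      have "(\<Sum>a\<in>A. (cmod (coord (F n) a - coord (F m) a))\<^sup>2) \<le> e\<^sup>2" if "m \<ge> N" for m
      proof -
        have "(\<Sum>a\<in>A. (cmod (coord (F n) a - coord (F m) a))\<^sup>2) \<le> (norm (F n - F m))\<^sup>2"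
          using sum_coord_le[OF \<open>finite A\<close>, of "F n - F m"] by simp
        also have "\<dots> \<le> e\<^sup>2"
          using N \<open>n \<ge> N\<close> that by (intro power_mono) (auto simp: dist_norm less_imp_le)
        finally show ?thesis .
      qed
      then show "\<exists>M. \<forall>m\<ge>M. (\<Sum>a\<in>A. (cmod (coord (F n) a - coord (F m) a))\<^sup>2) \<le> e\<^sup>2"
        by blast
    qed
    then show ?thesis by blast
  qed
  have summ: "(\<lambda>a. (cmod (coord (F n) a - f a))\<^sup>2) summable_on UNIV"
    if "\<And>A. finite A \<Longrightarrow> (\<Sum>a\<in>A. (cmod (coord (F n) a - f a))\<^sup>2) \<le> e\<^sup>2" for n and e :: real
    by (rule nonneg_bdd_above_summable_on) (auto intro!: bdd_aboveI2 that)
  obtain N where "\<And>A. finite A \<Longrightarrow> (\<Sum>a\<in>A. (cmod (coord (F N) a - f a))\<^sup>2) \<le> 1\<^sup>2"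
    using bound[of 1] by force
  from summ[OF this] have "(\<lambda>a. (cmod (f a))\<^sup>2) summable_on UNIV"
    using square_summable_add[OF square_summable_coord[of "F N"],
        of "\<lambda>a. f a - coord (F N) a"]
    by (simp add: norm_minus_commute)
  then have [simp]: "coord (Ell2 f) = f"
    by (simp add: Ell2_inverse)
  have "F \<longlonglongrightarrow> Ell2 f"
  proof (rule metric_LIMSEQ_I)
    fix e :: real assume "e > 0"
    then obtain N where N: "\<And>n A. n \<ge> N \<Longrightarrow> finite A
        \<Longrightarrow> (\<Sum>a\<in>A. (cmod (coord (F n) a - f a))\<^sup>2) \<le> (e/2)\<^sup>2"
      using bound[OF half_gt_zero[OF \<open>e > 0\<close>]] by blast
    have "dist (F n) (Ell2 f) < e" if "n \<ge> N" for n
    proof -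
      have "(norm (F n - Ell2 f))\<^sup>2 \<le> (e/2)\<^sup>2"
        unfolding norm_ell2_square
        by (rule infsum_le_finite_sums[OF square_summable_coord]) (use N[OF that] in auto)
      then have "norm (F n - Ell2 f) \<le> e/2"
        by (rule power2_le_imp_le) (use \<open>e > 0\<close> in auto)
      with \<open>e > 0\<close> show ?thesis
        unfolding dist_norm by linarith
    qed
    then show "\<exists>N. \<forall>n\<ge>N. dist (F n) (Ell2 f) < e"
      by blast
  qed
  then show "convergent F"
    by (auto simp: convergent_def)
qed

section \<open>Orthogonal projection onto a closed subspace\<close>

text \<open>The parallelogram law makes a minimising sequence Cauchy. If \<open>x - p\<close> had a
  component along some \<open>k\<close>, moving \<open>p\<close> along \<open>k\<close> would
  decrease the distance.\<close>

lemma projection_exists: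
  fixes K :: "'a :: {real_inner, complete_space} set"
  assumes "subspace K" "closed K"
  obtains p where "p \<in> K" "\<And>k. k \<in> K \<Longrightarrow> inner (x - p) k = 0"
proof -
  define m where "m = infdist x K"
  have "K \<noteq> {}"
    using assms subspace_0 by blast
  have m_le: "m \<le> norm (x - k)" if "k \<in> K" for k
    using infdist_le[OF that, of x] by (simp add: m_def dist_norm)
  have "\<exists>k\<in>K. (norm (x - k))\<^sup>2 < m\<^sup>2 + inverse (Suc n)" for n
  proof -
    have "m < sqrt (m\<^sup>2 + inverse (Suc n))"
      by (rule real_less_rsqrt) simp
    then obtain k where "k \<in> K" "dist x k < sqrt (m\<^sup>2 + inverse (Suc n))"
      unfolding m_def infdist_notempty[OF \<open>K \<noteq> {}\<close>]
      by (subst (asm) cINF_less_iff) (auto simp: \<open>K \<noteq> {}\<close>)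
    then show ?thesis
      by (intro bexI[of _ k]) (auto simp: dist_norm dest: real_less_lsqrt
          intro: order_less_le_trans[OF power_strict_mono[of _ _ 2]])
  qed
  then obtain s where sK: "\<And>n. s n \<in> K" and s: "\<And>n. (norm (x - s n))\<^sup>2 < m\<^sup>2 + inverse (Suc n)"
    by metis
  have par: "(norm (s i - s j))\<^sup>2 \<le> 2 * inverse (Suc i) + 2 * inverse (Suc j)" for i j
  proof -
    have "(1/2) *\<^sub>R (s i + s j) \<in> K"
      using assms sK by (simp add: subspace_add subspace_scale)
    from m_le[OF this] have "m\<^sup>2 \<le> (norm (x - (1/2) *\<^sub>R (s i + s j)))\<^sup>2"
      by (intro power_mono) (auto simp: m_def infdist_nonneg)
    moreover have "(norm (s i - s j))\<^sup>2 =
        2 * (norm (x - s i))\<^sup>2 + 2 * (norm (x - s j))\<^sup>2 - 4 * (norm (x - (1/2) *\<^sub>R (s i + s j)))\<^sup>2"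
      unfolding power2_norm_eq_inner
      by (simp add: inner_simps inner_commute algebra_simps)
    ultimately show ?thesis
      using s[of i] s[of j] by linarith
  qed
  have "Cauchy s"
  proof (rule metric_CauchyI)
    fix e :: real assume "e > 0"
    then obtain N where N: "inverse (real (Suc N)) < e\<^sup>2 / 4"
      using reals_Archimedean[of "e\<^sup>2 / 4"] by auto
    have "dist (s i) (s j) < e" if "i \<ge> N" "j \<ge> N" for i j
    proof -
      have "inverse (real (Suc i)) \<le> inverse (real (Suc N))"
        "inverse (real (Suc j)) \<le> inverse (real (Suc N))"
        using that by (auto intro!: le_imp_inverse_le)
      then have "(norm (s i - s j))\<^sup>2 < e\<^sup>2"
        using par[of i j] N by linarith
      then show ?thesis
        using \<open>e > 0\<close> by (simp add: dist_norm power2_less_imp_less)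
    qed
    then show "\<exists>M. \<forall>m\<ge>M. \<forall>n\<ge>M. dist (s m) (s n) < e"
      by blast
  qed
  then obtain p where p: "s \<longlonglongrightarrow> p"
    using Cauchy_convergent convergent_def by blast
  have "p \<in> K"
    using closed_sequentially[OF \<open>closed K\<close> sK p] .
  have "(norm (x - p))\<^sup>2 \<le> m\<^sup>2"
  proof (rule LIMSEQ_le)
    show "(\<lambda>n. (norm (x - s n))\<^sup>2) \<longlonglongrightarrow> (norm (x - p))\<^sup>2"
      by (intro tendsto_intros p)
    show "(\<lambda>n. m\<^sup>2 + inverse (real (Suc n))) \<longlonglongrightarrow> m\<^sup>2"
      using tendsto_add[OF tendsto_const LIMSEQ_inverse_real_of_nat, of "m\<^sup>2"] by simp
  qed (use s in \<open>auto intro: less_imp_le\<close>)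
  have "inner (x - p) k = 0" if "k \<in> K" for k
  proof (rule ccontr)
    define c where "c = inner (x - p) k"
    assume "inner (x - p) k \<noteq> 0"
    then have "c \<noteq> 0" "k \<noteq> 0"
      by (auto simp: c_def)
    then have kk: "inner k k > 0"
      by simp
    define t where "t = c / inner k k"
    have "p + t *\<^sub>R k \<in> K"
      using \<open>p \<in> K\<close> that assms by (simp add: subspace_add subspace_scale)
    from m_le[OF this] have "m\<^sup>2 \<le> (norm (x - (p + t *\<^sub>R k)))\<^sup>2"
      by (intro power_mono) (auto simp: m_def infdist_nonneg)
    also have "\<dots> = (norm (x - p))\<^sup>2 - 2 * t * c + t\<^sup>2 * inner k k"
      unfolding power2_norm_eq_inner c_def
      by (simp add: inner_simps inner_commute power2_eq_square algebra_simps)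
    also have "\<dots> = (norm (x - p))\<^sup>2 - c\<^sup>2 / inner k k"
      using kk by (simp add: t_def power2_eq_square)
    finally show False
      using \<open>(norm (x - p))\<^sup>2 \<le> m\<^sup>2\<close> kk \<open>c \<noteq> 0\<close> by (smt (verit) divide_pos_pos zero_less_power2)
  qed
  with \<open>p \<in> K\<close> show ?thesis
    using that by blast
qed

section \<open>Translations, coin and step operators\<close>


text \<open>The default 0 for non-bijective \<open>p\<close> makes the lifting and linearity
  unconditional.\<close>

lift_definition reindex :: "('a \<Rightarrow> 'a) \<Rightarrow> 'a ell2 \<Rightarrow> 'a ell2" is
  "\<lambda>p f a. if bij p then f (p a) else 0"
proof -
  fix p :: "'a \<Rightarrow> 'a" and f :: "'a \<Rightarrow> complex"
  assume "(\<lambda>a. (cmod (f a))\<^sup>2) summable_on UNIV"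
  then show "(\<lambda>a. (cmod (if bij p then f (p a) else 0))\<^sup>2) summable_on UNIV"
    using summable_on_reindex_bij_betw[of p UNIV UNIV "\<lambda>a. (cmod (f a))\<^sup>2"]
    by (cases "bij p") auto
qed

lemma coord_reindex: "bij p \<Longrightarrow> coord (reindex p f) a = coord f (p a)"
  by (simp add: reindex.rep_eq)

lemma linear_reindex [simp]: "linear (reindex p)"
  by (rule linearI; rule ell2_eqI) (simp_all add: reindex.rep_eq)

lemma inner_reindex: "bij p \<Longrightarrow> inner (reindex p f) (reindex p g) = inner f g"
  unfolding inner_ell2_def
  by (subst (2) infsum_reindex_bij_betw[of p UNIV UNIV, symmetric]) (simp_all add: reindex.rep_eq)

type_synonym walk = "((nat \<Rightarrow> int) \<times> nat) ell2"

definition translate :: "(nat \<Rightarrow> int) \<Rightarrow> walk \<Rightarrow> walk" where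
  "translate v = reindex (\<lambda>(x, j). (\<lambda>i. x i - v i, j))"

definition shift :: "nat \<Rightarrow> walk \<Rightarrow> walk" where
  "shift d = reindex (\<lambda>(x, j). (\<lambda>i. x i - shift_of d j i, j))"

definition shift_inv :: "nat \<Rightarrow> walk \<Rightarrow> walk" where
  "shift_inv d = reindex (\<lambda>(x, j). (\<lambda>i. x i + shift_of d j i, j))"

text \<open>The coin is assembled from cyclic rotations of the coin index, so that it is a combination of
  unitary reindexings. On the junk coin indices \<open>j \<ge> D\<close> the walk is the identity; the subspace
  \<open>supported d\<close> below excludes them.\<close>

definition rot :: "nat \<Rightarrow> nat \<Rightarrow> walk \<Rightarrow> walk" where
  "rot D c = reindex (\<lambda>(x, j). (x, if j < D then (j + c) mod D else j))"

definition coin_sum :: "nat \<Rightarrow> walk \<Rightarrow> walk" where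
  "coin_sum D f = (\<Sum>c<D. rot D c f)"

lemma bij_fibrewise_translation: "bij (\<lambda>(x, j). (\<lambda>i. x i - w j i :: int, j))"
  by (rule bij_betw_byWitness[where f' = "\<lambda>(x, j). (\<lambda>i. x i + w j i, j)"]) auto

lemma coord_translate: "coord (translate v f) (x, j) = coord f (\<lambda>i. x i - v i, j)"
  unfolding translate_def
  by (subst coord_reindex[OF bij_fibrewise_translation[of "\<lambda>_. v"]]) simp

lemma coord_shift: "coord (shift d f) (x, j) = coord f (\<lambda>i. x i - shift_of d j i, j)"
  unfolding shift_def
  by (subst coord_reindex[OF bij_fibrewise_translation[of "shift_of d"]]) simp

lemma coord_shift_inv: "coord (shift_inv d f) (x, j) = coord f (\<lambda>i. x i + shift_of d j i, j)"
  unfolding shift_inv_def using bij_fibrewise_translation[of "\<lambda>j i. - shift_of d j i"]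
  by (simp add: coord_reindex)

lemma inner_translate: "inner (translate v f) (translate v g) = inner f g"
  unfolding translate_def by (rule inner_reindex[OF bij_fibrewise_translation[of "\<lambda>_. v"]])

lemma inner_shift: "inner (shift d f) (shift d g) = inner f g"
  unfolding shift_def by (rule inner_reindex[OF bij_fibrewise_translation[of "shift_of d"]])

lemma bij_betw_add_mod: "bij_betw (\<lambda>j. (j + c) mod D) {..<D} {..<D::nat}"
proof (rule bij_betw_imageI)
  show "inj_on (\<lambda>j. (j + c) mod D) {..<D}"
  proof (rule inj_onI)
    fix i j assume "i \<in> {..<D}" "j \<in> {..<D}" "(i + c) mod D = (j + c) mod D"
    then obtain q r where "i + D * q = j + D * r"
      unfolding nat_mod_eq_iff by auto
    then have "(i + D * q) mod D = (j + D * r) mod D"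
      by (rule arg_cong)
    with \<open>i \<in> {..<D}\<close> \<open>j \<in> {..<D}\<close> show "i = j"
      by simp
  qed
  then show "(\<lambda>j. (j + c) mod D) ` {..<D} = {..<D}"
    by (intro endo_inj_surj) (auto intro!: mod_less_divisor)
qed

lemma bij_rot: "bij (\<lambda>(x :: nat \<Rightarrow> int, j). (x, if j < D then (j + c) mod D else j :: nat))"
proof -
  have "bij_betw (\<lambda>j. if j < D then (j + c) mod D else j) {..<D} {..<D}"
    using bij_betw_add_mod[of c D] by (rule bij_betw_cong[THEN iffD1, rotated]) simp
  moreover have "bij_betw (\<lambda>j. if j < D then (j + c) mod D else j) {D..} {D..}"
    by (auto simp: bij_betw_def inj_on_def image_def)
  ultimately have "bij_betw (\<lambda>j. if j < D then (j + c) mod D else j) ({..<D} \<union> {D..}) ({..<D} \<union> {D..})"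
    by (rule bij_betw_combine) auto
  then have "bij (\<lambda>j. if j < D then (j + c) mod D else j)"
    by (simp add: Un_def not_less[symmetric])
  then have "bij (map_prod (id :: (nat \<Rightarrow> int) \<Rightarrow> _) (\<lambda>j. if j < D then (j + c) mod D else j))"
    by (intro bij_betw_map_prod[of _ UNIV UNIV _ UNIV UNIV, simplified]) auto
  then show ?thesis
    by (simp add: map_prod_def id_def)
qed

lemma coord_rot:
  "coord (rot D c f) (x, j) = coord f (x, if j < D then (j + c) mod D else j)"
  unfolding rot_def using bij_rot[of D c] by (simp add: coord_reindex)

lemma coord_sum: "coord (sum F A) a = (\<Sum>i\<in>A. coord (F i) a)"
  by (induction A rule: infinite_finite_induct) auto

lemma coord_coin_sum:
  "coord (coin_sum D f) (x, j) =
    (if j < D then \<Sum>i<D. coord f (x, i) else of_nat D * coord f (x, j))"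
proof (cases "j < D")
  case True
  have "(\<Sum>c<D. coord f (x, (j + c) mod D)) = (\<Sum>i<D. coord f (x, i))"
    using sum.reindex_bij_betw[OF bij_betw_add_mod[of j D], of "\<lambda>i. coord f (x, i)"]
    by (simp add: add.commute)
  with True show ?thesis
    by (simp add: coin_sum_def coord_sum coord_rot)
qed (simp add: coin_sum_def coord_sum coord_rot)

lemma linear_coin_sum: "linear (coin_sum D)"
  unfolding coin_sum_def rot_def by (intro linear_compose_sum) simp

text \<open>Rotations are isometric and fix the range of C = \<open>coin_sum D\<close>, so <C f, C
  g> = D <f, C g>. The left side is symmetric in f and g.\<close>

lemma inner_coin_sum: "inner (coin_sum D f) g = inner f (coin_sum D g)"
proof (cases "D = 0")
  case False
  have "rot D c (coin_sum D f) = coin_sum D f" for c f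
    by (rule ell2_eqI) (auto simp: coord_rot coord_coin_sum split: prod.split)
  moreover have "inner (rot D c f) (rot D c g) = inner f g" for c f g
    unfolding rot_def by (rule inner_reindex[OF bij_rot])
  ultimately have "inner (rot D c f) (coin_sum D g) = inner f (coin_sum D g)" for c f g
    by metis
  then have *: "inner (coin_sum D f) (coin_sum D g) = D * inner f (coin_sum D g)" for f g
    by (subst coin_sum_def) (simp add: inner_sum_left)
  show ?thesis
    using *[of f g] *[of g f] False by (simp add: inner_commute)
qed (simp add: coin_sum_def)

definition coin :: "nat \<Rightarrow> walk \<Rightarrow> walk" where
  "coin d f = (2 / real (2*d+1)) *\<^sub>R coin_sum (2*d+1) f - f"

definition step :: "nat \<Rightarrow> walk \<Rightarrow> walk" where
  "step d f = shift d (coin d f)"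

definition step_inv :: "nat \<Rightarrow> walk \<Rightarrow> walk" where
  "step_inv d f = coin d (shift_inv d f)"

definition amp_sum :: "nat \<Rightarrow> walk \<Rightarrow> (nat \<Rightarrow> int) \<Rightarrow> complex" where
  "amp_sum d f x = (\<Sum>i<2*d+1. coord f (x, i))"

lemma coord_coin:
  "coord (coin d f) (x, j) =
    (if j < 2*d+1 then 2 / of_nat (2*d+1) * amp_sum d f x - coord f (x, j) else coord f (x, j))"
proof -
  have "complex_of_nat (2*d+1) \<noteq> 0"
    by (metis add_is_0 of_nat_eq_0_iff one_neq_zero)
  then show ?thesis
    by (simp add: coin_def coord_coin_sum amp_sum_def del: of_nat_add of_nat_mult)
qed

lemma linear_coin: "linear (coin d)"
  unfolding coin_def
  by (intro linear_compose_sub linear_compose_scale_right linear_coin_sum linear_ident)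

lemma inner_coin: "inner (coin d f) g = inner f (coin d g)"
  by (simp add: coin_def inner_diff_left inner_diff_right inner_coin_sum)

text \<open>The coin preserves coin sums, because D (2/D) s - s = s; the second reflection therefore
  undoes the first.\<close>

lemma coin_coin [simp]: "coin d (coin d f) = f"
proof -
  have *: "complex_of_nat (2*d+1) \<noteq> 0"
    by (metis add_is_0 of_nat_eq_0_iff one_neq_zero)
  have "amp_sum d (coin d f) x = amp_sum d f x" for x
  proof -
    have "amp_sum d (coin d f) x =
        (\<Sum>i<2*d+1. 2 / of_nat (2*d+1) * amp_sum d f x - coord f (x, i))"
      unfolding amp_sum_def[of d "coin d f"] by (intro sum.cong) (auto simp: coord_coin)
    also have "\<dots> = of_nat (2*d+1) * (2 / of_nat (2*d+1) * amp_sum d f x) - amp_sum d f x"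
      unfolding sum_subtractf amp_sum_def by (simp only: sum_constant card_lessThan)
    also have "\<dots> = amp_sum d f x"
      using * by (simp add: field_simps del: of_nat_add of_nat_mult)
    finally show ?thesis .
  qed
  then show ?thesis
    by (intro ell2_eqI) (auto simp: coord_coin split: prod.split)
qed

lemma shift_shift_inv [simp]: "shift d (shift_inv d f) = f" "shift_inv d (shift d f) = f"
  by (rule ell2_eqI, auto simp: coord_shift coord_shift_inv)+

lemma step_step_inv [simp]: "step d (step_inv d f) = f" "step_inv d (step d f) = f"
  by (simp_all add: step_def step_inv_def)

lemma linear_translate: "linear (translate v)"
  by (simp add: translate_def)

lemma linear_step: "linear (step d)"
  using linear_compose[OF linear_coin, of "shift d" d]
  by (simp add: step_def[abs_def] shift_def o_def)

lemma linear_step_inv: "linear (step_inv d)"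
  using linear_compose[OF _ linear_coin, of "shift_inv d" d]
  by (simp add: step_inv_def[abs_def] shift_inv_def o_def)

lemma inner_step: "inner (step d f) (step d g) = inner f g"
  by (simp add: step_def inner_shift inner_coin)

lemma inner_step_adjoint: "inner (step d f) g = inner f (step_inv d g)"
  by (metis inner_step step_step_inv(1))

lemma inner_step_inv_adjoint: "inner (step_inv d f) g = inner f (step d g)"
  by (metis inner_step step_step_inv(1))

lemma norm_step [simp]: "norm (step d f) = norm f"
  by (simp add: norm_eq_sqrt_inner inner_step)

lemma translate_translate [simp]: "translate v (translate w f) = translate (\<lambda>i. v i + w i) f"
  by (rule ell2_eqI) (auto simp: coord_translate algebra_simps)

lemma translate_0 [simp]: "translate (\<lambda>_. 0) f = f"
  by (rule ell2_eqI) (auto simp: coord_translate)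

lemma inner_translate_adjoint: "inner (translate v f) g = inner f (translate (\<lambda>i. - v i) g)"
  using inner_translate[of v f "translate (\<lambda>i. - v i) g"] by simp

text \<open>On junk indices the shift is zero and the right-hand side collapses to 2 f - f; the
  factor 2 lets both cases share the subtracted term.\<close>

lemma coord_step:
  "coord (step d f) (x, j) =
    (if j < 2*d+1 then 2 / of_nat (2*d+1) * amp_sum d f (\<lambda>i. x i - shift_of d j i) else
      2 * coord f (x, j)) - coord f (\<lambda>i. x i - shift_of d j i, j)"
  by (simp add: step_def coord_shift coord_coin shift_of_def)

lemma step_translate: "step d (translate v f) = translate v (step d f)"
  by (rule ell2_eqI) (auto simp: coord_step coord_translate amp_sum_def algebra_simps split: prod.split)

lemma step_inv_translate: "step_inv d (translate v f) = translate v (step_inv d f)"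
  by (metis step_step_inv step_translate)

text \<open>A subspace instead of a type of its own, so that the type \<open>walk\<close> does not
  depend on \<open>d\<close>.\<close>

definition supported :: "nat \<Rightarrow> walk set" where
  "supported d = {f. \<forall>x j. x \<notin> lat d \<or> 2*d+1 \<le> j \<longrightarrow> coord f (x, j) = 0}"

lemma lat_add: "v \<in> lat d \<Longrightarrow> (\<lambda>i. x i + v i) \<in> lat d \<longleftrightarrow> x \<in> lat d"
  by (auto simp: lat_def)

lemma lat_diff: "v \<in> lat d \<Longrightarrow> (\<lambda>i. x i - v i) \<in> lat d \<longleftrightarrow> x \<in> lat d"
  by (auto simp: lat_def)

lemma lat_uminus: "v \<in> lat d \<Longrightarrow> (\<lambda>i. - v i) \<in> lat d"
  by (auto simp: lat_def)

lemma unit_vec_in_lat: "i < d \<Longrightarrow> unit_vec i \<in> lat d"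
  by (auto simp: lat_def unit_vec_def)

lemma shift_of_in_lat: "shift_of d j \<in> lat d"
  by (auto simp: lat_def unit_vec_def shift_of_def)

lemma shift_of_simps:
  "i < d \<Longrightarrow> shift_of d i = unit_vec i"
  "shift_of d d = (\<lambda>_. 0)"
  "i < d \<Longrightarrow> shift_of d (d + 1 + i) = (\<lambda>k. - unit_vec i k)"
  by (auto simp: shift_of_def)

lemma shift_of_inj:
  assumes "shift_of d j = shift_of d k" "j < 2*d+1" "k < 2*d+1"
  shows "j = k"
proof -
  have *: "shift_of d j k = (if j < d \<and> j = k then 1 else if d < j \<and> j = d + 1 + k then -1 else 0)"
    if "j < 2*d+1" for j k
    using that by (auto simp: shift_of_def unit_vec_def)
  have eq: "shift_of d j m = shift_of d k m" for m
    by (simp add: assms(1))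
  consider "j < d" | "j = d" | "d < j"
    by linarith
  then show ?thesis
  proof cases
    case 1
    then have "shift_of d k j = 1"
      using *[OF assms(2), of j] eq[of j] by simp
    then show ?thesis
      using *[OF assms(3), of j] by (simp split: if_splits)
  next
    case 2
    then have "shift_of d k m = 0" for m
      using *[OF assms(2), of m] eq[of m] by simp
    then have "\<not> k < d" "\<not> d < k"
      using *[OF assms(3), of k] *[OF assms(3), of "k - d - 1"] by auto
    with 2 show ?thesis
      by simp
  next
    case 3
    then have "shift_of d k (j - d - 1) = - 1"
      using *[OF assms(2), of "j - d - 1"] eq[of "j - d - 1"] by simp
    then show ?thesis
      using *[OF assms(3), of "j - d - 1"] 3 by (simp split: if_splits)
  qed
qed

lemma subspace_supported: "subspace (supported d)"
  by (auto simp: subspace_def supported_def)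

lemma supported_translate: "f \<in> supported d \<Longrightarrow> v \<in> lat d \<Longrightarrow> translate v f \<in> supported d"
  by (auto simp: supported_def coord_translate lat_diff)

lemma supported_coin: "f \<in> supported d \<Longrightarrow> coin d f \<in> supported d"
  by (auto simp: supported_def coord_coin amp_sum_def)

lemma supported_step: "f \<in> supported d \<Longrightarrow> step d f \<in> supported d"
  unfolding step_def using supported_coin[of f d]
  by (auto simp: supported_def coord_shift lat_diff shift_of_in_lat)

lemma supported_step_inv: "f \<in> supported d \<Longrightarrow> step_inv d f \<in> supported d"
  unfolding step_inv_def
  by (rule supported_coin) (auto simp: supported_def coord_shift_inv lat_add shift_of_in_lat)

lemma supported_eq_0I:
  assumes "f \<in> supported d" "\<And>x j. j < 2*d+1 \<Longrightarrow> coord f (x, j) = 0"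
  shows "f = 0"
  using assms by (intro ell2_eqI) (auto simp: supported_def not_less[symmetric])

section \<open>Square-summability against periodicity\<close>

text \<open>The orbit of a point under a nonzero translation is infinite, so arbitrarily many copies
  of one value would have to fit under the squared norm.\<close>

lemma coord_eq_0_if_periodic:
  fixes f :: walk
  assumes "u \<noteq> (\<lambda>_. 0)" and per: "\<And>x. coord f (\<lambda>i. x i + u i, j) = coord f (x, j)"
  shows "coord f (x, j) = 0"
proof -
  obtain i where i: "u i \<noteq> 0"
    using assms(1) by auto
  define p where "p n = ((\<lambda>i. x i + int n * u i), j)" for n
  have "inj p"
  proof (rule injI)
    fix m n assume "p m = p n"
    then have "x i + int m * u i = x i + int n * u i"
      unfolding p_def by (metis Pair_inject)
    with i show "m = n"
      by simp
  qed
  have const: "coord f (p n) = coord f (x, j)" for n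
  proof (induction n)
    case (Suc n)
    have "p (Suc n) = (\<lambda>i. (x i + int n * u i) + u i, j)"
      by (simp add: p_def algebra_simps)
    then show ?case
      using per[of "\<lambda>i. x i + int n * u i"] Suc by (simp add: p_def)
  qed (simp add: p_def)
  have bound: "real n * (cmod (coord f (x, j)))\<^sup>2 \<le> (norm f)\<^sup>2" for n
  proof -
    have "real n * (cmod (coord f (x, j)))\<^sup>2 = (\<Sum>a\<in>p ` {..<n}. (cmod (coord f a))\<^sup>2)"
      using \<open>inj p\<close> by (subst sum.reindex) (auto simp: const inj_on_def)
    also have "\<dots> \<le> (norm f)\<^sup>2"
      by (rule sum_coord_le) simp
    finally show ?thesis .
  qed
  show ?thesis
  proof (rule ccontr)
    assume "coord f (x, j) \<noteq> 0"
    then have "(cmod (coord f (x, j)))\<^sup>2 > 0"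
      by simp
    then obtain n where "(norm f)\<^sup>2 < real n * (cmod (coord f (x, j)))\<^sup>2"
      using reals_Archimedean3 by blast
    with bound[of n] show False
      by simp
  qed
qed

lemma coord_eq_0_if_shifts_agree:
  fixes f :: walk
  assumes "v \<noteq> w" and eq: "\<And>x. coord f (\<lambda>i. x i - v i, j) = coord f (\<lambda>i. x i - w i, j)"
  shows "coord f (x, j) = 0"
proof (rule coord_eq_0_if_periodic)
  show "(\<lambda>i. v i - w i) \<noteq> (\<lambda>_. 0)"
    using assms(1) by (auto simp: fun_eq_iff)
  show "coord f (\<lambda>i. x i + (v i - w i), j) = coord f (x, j)" for x
    using eq[of "\<lambda>i. x i + v i"] by (simp add: algebra_simps)
qed

text \<open>The \<open>j\<close>-th coordinate of \<open>U f + z f\<close>, with \<open>z\<close> the translation attached to coin index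
  \<open>k\<close>, compares two translates of the \<open>j\<close>-th coordinate of \<open>f\<close> up to the coin sum; for
  \<open>j = k\<close> they coincide, so the coin sum vanishes.\<close>

lemma step_plus_translate_inj:
  assumes "f \<in> supported d" "k < 2*d+1" "step d f + translate (shift_of d k) f = 0"
  shows "f = 0"
proof -
  have eq: "2 / of_nat (2*d+1) * amp_sum d f (\<lambda>i. x i - shift_of d j i)
      = coord f (\<lambda>i. x i - shift_of d j i, j) - coord f (\<lambda>i. x i - shift_of d k i, j)"
    if "j < 2*d+1" for x j
  proof -
    have "coord (step d f + translate (shift_of d k) f) (x, j) = 0"
      by (simp add: assms)
    with that show ?thesis
      by (simp add: coord_step coord_translate algebra_simps)
  qed
  have D: "complex_of_nat (2*d+1) \<noteq> 0"
    by (metis add_is_0 of_nat_eq_0_iff one_neq_zero)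
  have amp_sum: "amp_sum d f x = 0" for x
    using eq[OF assms(2), of "\<lambda>i. x i + shift_of d k i"] D
    by (simp del: of_nat_add of_nat_mult)
  have off: "coord f (x, j) = 0" if "j < 2*d+1" "j \<noteq> k" for x j
  proof (rule coord_eq_0_if_shifts_agree)
    show "shift_of d j \<noteq> shift_of d k"
      using that assms(2) shift_of_inj by blast
    show "coord f (\<lambda>i. x i - shift_of d j i, j) = coord f (\<lambda>i. x i - shift_of d k i, j)" for x
      using eq[OF that(1), of x] by (simp add: amp_sum)
  qed
  \<comment> \<open>The remaining coordinate cannot be treated by periodicity; it is all that is
    left of the vanishing coin sum.\<close>
  have "coord f (x, k) = 0" for x
  proof -
    have "amp_sum d f x = coord f (x, k) + (\<Sum>i\<in>{..<2*d+1} - {k}. coord f (x, i))"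
      unfolding amp_sum_def using assms(2) by (intro sum.remove) auto
    with amp_sum show ?thesis
      by (simp add: off)
  qed
  with off show ?thesis
    by (intro supported_eq_0I[OF assms(1)]) metis
qed

section \<open>The commutative algebra generated by the walk and the translations\<close>


abbreviation fwd :: "nat \<Rightarrow> walk \<Rightarrow> walk" where
  "fwd i \<equiv> translate (unit_vec i)"

abbreviation bwd :: "nat \<Rightarrow> walk \<Rightarrow> walk" where
  "bwd i \<equiv> translate (\<lambda>k. - unit_vec i k)"

text \<open>Laurent polynomials in U and the translations, given by generators so that their
  properties follow by rule induction. The bound \<open>n\<close> records which translations may
  occur: with the position coordinate \<open>k\<close>, for \<open>n \<le> k\<close>, only the
  powers of U fail to commute.\<close>

inductive alg :: "nat \<Rightarrow> nat \<Rightarrow> (walk \<Rightarrow> walk) \<Rightarrow> bool" for d n where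
  ident: "alg d n (\<lambda>f. f)"
| step: "alg d n (step d)"
| step_inv: "alg d n (step_inv d)"
| fwd: "i < n \<Longrightarrow> alg d n (fwd i)"
| bwd: "i < n \<Longrightarrow> alg d n (bwd i)"
| add: "alg d n A \<Longrightarrow> alg d n B \<Longrightarrow> alg d n (\<lambda>f. A f + B f)"
| scale: "alg d n A \<Longrightarrow> alg d n (\<lambda>f. r *\<^sub>R A f)"
| comp: "alg d n A \<Longrightarrow> alg d n B \<Longrightarrow> alg d n (\<lambda>f. A (B f))"

lemma alg_linear: "alg d n A \<Longrightarrow> linear A"
proof (induction rule: alg.induct)
  case (comp A B)
  then show ?case
    using linear_compose[of B A] by (simp add: o_def)
qed (auto intro: linear_step linear_step_inv linear_translate linear_compose_add
    linear_compose_scale_right linear_ident)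

lemma alg_diff: "alg d n A \<Longrightarrow> alg d n B \<Longrightarrow> alg d n (\<lambda>f. A f - B f)"
  using alg.add[OF _ alg.scale[of d n B "-1"]] by simp

lemma alg_supported: "alg d n A \<Longrightarrow> n \<le> d \<Longrightarrow> f \<in> supported d \<Longrightarrow> A f \<in> supported d"
proof (induction arbitrary: f rule: alg.induct)
  case (add A B)
  then show ?case
    by (simp add: subspace_add subspace_supported)
next
  case (scale A r)
  then show ?case
    by (simp add: subspace_scale subspace_supported)
qed (auto intro!: supported_step supported_step_inv supported_translate lat_uminus unit_vec_in_lat)

lemma alg_step_commute: "alg d n A \<Longrightarrow> A (step d f) = step d (A f)"
  by (induction arbitrary: f rule: alg.induct)
    (simp_all add: step_translate linear_add[OF linear_step] linear_scale[OF linear_step])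

lemma alg_step_inv_commute: "alg d n A \<Longrightarrow> A (step_inv d f) = step_inv d (A f)"
  by (metis alg_step_commute step_step_inv)

lemma alg_translate_commute: "alg d n A \<Longrightarrow> A (translate v f) = translate v (A f)"
  by (induction arbitrary: f rule: alg.induct)
    (simp_all add: step_translate step_inv_translate linear_add[OF linear_translate]
      linear_scale[OF linear_translate] add.commute)

lemma alg_commute: "alg d n A \<Longrightarrow> alg d m B \<Longrightarrow> A (B f) = B (A f)"
proof (induction arbitrary: f rule: alg.induct)
  case (add A B')
  then show ?case
    using alg_linear[of d m B] by (simp add: linear_add)
next
  case (scale A r)
  then show ?case
    using alg_linear[of d m B] by (simp add: linear_scale)
qed (simp_all add: alg_step_commute alg_step_inv_commute alg_translate_commute)

text \<open>Write \<open>U = step d\<close>, \<open>b_i = bop d i\<close> and \<open>u = uop d = (U + 1)^2 / U\<close>. Then \<open>N = Nop d n\<close> is the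
  product of the \<open>b_i\<close> with \<open>i < n\<close>, and \<open>S = Sop d n\<close> is the sum over \<open>i < n\<close> of the products omitting
  \<open>b_i\<close>. For \<open>n = d\<close> the operator \<open>Rop d d = (U - 1) (N + 2 u S)\<close> is, up to a power of \<open>U\<close>, a multiple
  of the characteristic polynomial of the Fourier fibres of \<open>U\<close> evaluated at \<open>U\<close>. It equals
  \<open>(U - 1) (b_n Pop d n + 2 u N)\<close> for \<open>d = n + 1\<close>, and \<open>Qop d n\<close> is its derivative in the momentum
  of direction \<open>n\<close>. The normalisation by powers of \<open>U\<close> makes \<open>N\<close>, \<open>S\<close> and \<open>Pop\<close> self-adjoint.\<close>

definition bop :: "nat \<Rightarrow> nat \<Rightarrow> walk \<Rightarrow> walk" where
  "bop d i f = step d f + step_inv d f + fwd i f + bwd i f"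

definition uop :: "nat \<Rightarrow> walk \<Rightarrow> walk" where
  "uop d f = step d f + step_inv d f + 2 *\<^sub>R f"

primrec Nop :: "nat \<Rightarrow> nat \<Rightarrow> walk \<Rightarrow> walk" where
  "Nop d 0 f = f"
| "Nop d (Suc n) f = bop d n (Nop d n f)"

primrec Sop :: "nat \<Rightarrow> nat \<Rightarrow> walk \<Rightarrow> walk" where
  "Sop d 0 f = 0"
| "Sop d (Suc n) f = bop d n (Sop d n f) + Nop d n f"

definition Pop :: "nat \<Rightarrow> nat \<Rightarrow> walk \<Rightarrow> walk" where
  "Pop d n f = Nop d n f + 2 *\<^sub>R uop d (Sop d n f)"

definition Rop :: "nat \<Rightarrow> nat \<Rightarrow> walk \<Rightarrow> walk" where
  "Rop d n f = step d (Pop d n f) - Pop d n f"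

definition Qop :: "nat \<Rightarrow> nat \<Rightarrow> walk \<Rightarrow> walk" where
  "Qop d n f = fwd n (Rop d n f) - bwd n (Rop d n f)"

lemma alg_bop: "i < n \<Longrightarrow> alg d n (bop d i)"
  unfolding bop_def[abs_def] by (intro alg.add alg.step alg.step_inv alg.fwd alg.bwd)

lemma alg_uop: "alg d n (uop d)"
  unfolding uop_def[abs_def] by (intro alg.add alg.step alg.step_inv alg.scale alg.ident)

lemma alg_zero: "alg d n (\<lambda>f. 0)"
  using alg.scale[OF alg.ident, of d n 0] by simp

lemma alg_Nop: "n \<le> m \<Longrightarrow> alg d m (Nop d n)"
proof (induction n)
  case 0
  have "Nop d 0 = (\<lambda>f. f)"
    by (rule ext) simp
  then show ?case
    by (simp only: alg.ident)
next
  case (Suc n)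
  have "Nop d (Suc n) = (\<lambda>f. bop d n (Nop d n f))"
    by (rule ext) simp
  moreover have "alg d m (\<lambda>f. bop d n (Nop d n f))"
    using Suc by (intro alg.comp[of d m "bop d n" "Nop d n"] alg_bop) auto
  ultimately show ?case
    by (simp only:)
qed

lemma alg_Sop: "n \<le> m \<Longrightarrow> alg d m (Sop d n)"
proof (induction n)
  case 0
  have "Sop d 0 = (\<lambda>f. 0)"
    by (rule ext) simp
  then show ?case
    by (simp only: alg_zero)
next
  case (Suc n)
  have "Sop d (Suc n) = (\<lambda>f. bop d n (Sop d n f) + Nop d n f)"
    by (rule ext) simp
  moreover have "alg d m (\<lambda>f. bop d n (Sop d n f) + Nop d n f)"
    using Suc alg_Nop[of n m d]
    by (intro alg.add alg.comp[of d m "bop d n" "Sop d n"] alg_bop) auto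
  ultimately show ?case
    by (simp only:)
qed

lemma alg_Pop: "n \<le> m \<Longrightarrow> alg d m (Pop d n)"
  unfolding Pop_def[abs_def]
  by (intro alg.add alg.scale alg.comp[OF alg_uop] alg_Nop alg_Sop)

lemma alg_Rop: "n \<le> m \<Longrightarrow> alg d m (Rop d n)"
  unfolding Rop_def[abs_def]
  by (intro alg_diff alg.comp[OF alg.step] alg_Pop)

lemma alg_Qop: "n < m \<Longrightarrow> alg d m (Qop d n)"
  unfolding Qop_def[abs_def]
  by (intro alg_diff alg.comp[OF alg.fwd] alg.comp[OF alg.bwd] alg_Rop) auto

section \<open>The characteristic identity \<open>Rop d d = 0\<close>\<close>

lemma amp_sum_simps [simp]:
  "amp_sum d (f + g) x = amp_sum d f x + amp_sum d g x"
  "amp_sum d (f - g) x = amp_sum d f x - amp_sum d g x"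
  "amp_sum d (r *\<^sub>R f) x = of_real r * amp_sum d f x"
  "amp_sum d (translate v f) x = amp_sum d f (\<lambda>i. x i - v i)"
  by (simp_all add: amp_sum_def sum.distrib sum_subtractf sum_distrib_left coord_translate
      del: sum.lessThan_Suc)

lemma sum_coin_indices:
  fixes h :: "nat \<Rightarrow> 'a :: comm_monoid_add"
  shows "(\<Sum>j<2*d+1. h j) = (\<Sum>i<d. h i + h (d + 1 + i)) + h d"
proof -
  have "{..<2*d+1} = insert d ({..<d} \<union> (\<lambda>i. d + 1 + i) ` {..<d})"
  proof -
    have "j \<in> (\<lambda>i. d + 1 + i) ` {..<d}" if "d < j" "j < 2*d+1" for j
      using that by (intro image_eqI[of _ _ "j - (d + 1)"]) auto
    then have "j \<in> insert d ({..<d} \<union> (\<lambda>i. d + 1 + i) ` {..<d})" if "j < 2*d+1" for j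
      using that by (cases j d rule: linorder_cases) (blast intro: lessThan_iff[THEN iffD2])+
    then show ?thesis
      by auto
  qed
  moreover have "d \<notin> {..<d} \<union> (\<lambda>i. d + 1 + i) ` {..<d}" "{..<d} \<inter> (\<lambda>i. d + 1 + i) ` {..<d} = {}"
    by auto
  ultimately have "(\<Sum>j<2*d+1. h j) = h d + ((\<Sum>i<d. h i) + (\<Sum>j\<in>(\<lambda>i. d + 1 + i) ` {..<d}. h j))"
    by (simp only: sum.insert sum.union_disjoint finite_Un finite_imageI finite_lessThan
        simp_thms not_False_eq_True)
  also have "(\<Sum>j\<in>(\<lambda>i. d + 1 + i) ` {..<d}. h j) = (\<Sum>i<d. h (d + 1 + i))"
    by (subst sum.reindex) (auto simp: inj_on_def)
  finally show ?thesis
    by (simp add: sum.distrib add_ac)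
qed

lemma amp_sum_split:
  "amp_sum d f x = (\<Sum>i<d. coord f (x, i) + coord f (x, d + 1 + i)) + coord f (x, d)"
  unfolding amp_sum_def by (rule sum_coin_indices)

lemma coord_step_fst: "i < d \<Longrightarrow> coord (step d f) (x, i) =
    2 / of_nat (2*d+1) * amp_sum d f (\<lambda>k. x k - unit_vec i k) - coord f (\<lambda>k. x k - unit_vec i k, i)"
  by (simp add: coord_step shift_of_simps)

lemma coord_step_snd: "i < d \<Longrightarrow> coord (step d f) (x, d + 1 + i) =
    2 / of_nat (2*d+1) * amp_sum d f (\<lambda>k. x k + unit_vec i k) - coord f (\<lambda>k. x k + unit_vec i k, d + 1 + i)"
  using shift_of_simps(3)[of i d] by (simp add: coord_step del: of_nat_add of_nat_mult)

text \<open>The contribution z/(U + z) + (1/z)/(U + 1/z) = 1 - (U - 1/U)/b of a pair of opposite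
  shifts, with the denominator b cleared.\<close>

lemma coord_bop:
  assumes "i < d"
  shows "coord (bop d i h) (x, i) + coord (bop d i h) (x, d + 1 + i) =
    2 / of_nat (2*d+1) * amp_sum d (bop d i h - step d h + step_inv d h) x"
proof -
  define g where "g = step_inv d h"
  define c :: complex where "c = 2 / of_nat (2*d+1)"
  define k where "k = d + 1 + i"
  have h: "h = step d g"
    by (simp add: g_def)
  have g: "coord g (x, i) = c * amp_sum d g x - coord h (\<lambda>k. x k + unit_vec i k, i)"
    "coord g (x, k) = c * amp_sum d g x - coord h (\<lambda>k. x k - unit_vec i k, k)"
    unfolding h k_def coord_step_fst[OF assms] coord_step_snd[OF assms] c_def by simp_all
  show ?thesis
    unfolding bop_def g_def[symmetric] c_def[symmetric] k_def[symmetric]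
    by (simp add: g coord_step_fst[OF assms, folded c_def] coord_step_snd[OF assms, folded c_def k_def]
        coord_translate algebra_simps del: of_nat_add of_nat_mult)
qed

text \<open>The sum of the first \<open>n\<close> pair contributions n - (U - 1/U) S/N, multiplied
  by N.\<close>

lemma sum_coord_Nop:
  assumes "n \<le> d"
  shows "(\<Sum>i<n. coord (Nop d n f) (x, i) + coord (Nop d n f) (x, d + 1 + i)) =
    2 / of_nat (2*d+1) *
      amp_sum d (real n *\<^sub>R Nop d n f - step d (Sop d n f) + step_inv d (Sop d n f)) x"
  using assms
proof (induction n arbitrary: f)
  case 0
  then show ?case
    by (simp add: amp_sum_def linear_0[OF linear_step] linear_0[OF linear_step_inv])
next
  case (Suc n)
  define c :: complex where "c = 2 / of_nat (2*d+1)"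
  \<comment> \<open>The induction hypothesis is used at \<open>bop d n f\<close>: the new factor is
    moved inside the old product.\<close>
  have *: "Nop d (Suc n) f = Nop d n (bop d n f)" "bop d n (Sop d n f) = Sop d n (bop d n f)"
    "Nop d n (bop d n f) = bop d n (Nop d n f)"
    using alg_commute[OF alg_Nop[of n d d] alg_bop[of n d d]]
      alg_commute[OF alg_Sop[of n d d] alg_bop[of n d d]] Suc.prems by simp_all
  have "(\<Sum>i<Suc n. coord (Nop d (Suc n) f) (x, i) + coord (Nop d (Suc n) f) (x, d + 1 + i)) =
    c * amp_sum d (real n *\<^sub>R Nop d n (bop d n f) - step d (Sop d n (bop d n f))
      + step_inv d (Sop d n (bop d n f))) x
    + c * amp_sum d (bop d n (Nop d n f) - step d (Nop d n f) + step_inv d (Nop d n f)) x"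
    unfolding c_def sum.lessThan_Suc using Suc.IH[of "bop d n f"] coord_bop[of n d "Nop d n f" x] Suc.prems
    by (simp only: *(1) *(3))
  also have "\<dots> = c * amp_sum d (real (Suc n) *\<^sub>R Nop d (Suc n) f - step d (Sop d (Suc n) f)
      + step_inv d (Sop d (Suc n) f)) x"
    unfolding Sop.simps *(2) *(1)
    by (simp add: *(3) linear_add[OF linear_step] linear_add[OF linear_step_inv] algebra_simps)
  finally show ?case
    unfolding c_def .
qed

text \<open>The secular equation with all denominators cleared, which says that coin sums of
  \<open>Rop d d f\<close> vanish. Applying the pair sum to U f + f clears the denominator U + 1 of
  the zero shift.\<close>

lemma amp_sum_Rop: "amp_sum d (Rop d d f) x = 0"
proof -
  define D :: complex where "D = of_nat (2*d+1)"
  have "D \<noteq> 0"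
    unfolding D_def by (metis add_is_0 of_nat_eq_0_iff one_neq_zero)
  have D: "D = 2 * of_nat d + 1"
    by (simp add: D_def)
  define s where "s = Sop d d f"
  define n where "n = Nop d d f"
  have N: "Nop d d (step d f + f) = step d n + n" and S: "Sop d d (step d f + f) = step d s + s"
    using alg_linear[OF alg_Nop[of d d d]] alg_linear[OF alg_Sop[of d d d]]
      alg_step_commute[OF alg_Nop[of d d d]] alg_step_commute[OF alg_Sop[of d d d]]
    by (simp_all add: linear_add n_def s_def)
  have "amp_sum d (step d n + n) x =
      2 / D * amp_sum d (real d *\<^sub>R (step d n + n) - step d (step d s + s) + step_inv d (step d s + s)) x
      + coord (step d n + n) (x, d)"
    using sum_coord_Nop[of d d "step d f + f" x] unfolding N S
    by (subst amp_sum_split) (simp add: D_def del: of_nat_add of_nat_mult)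
  also have "coord (step d n + n) (x, d) = 2 / D * amp_sum d n x"
    by (simp add: coord_step shift_of_simps D_def)
  finally have "D * amp_sum d (step d n + n) x =
      2 * amp_sum d (real d *\<^sub>R (step d n + n) - step d (step d s + s) + step_inv d (step d s + s)) x
      + 2 * amp_sum d n x"
    using \<open>D \<noteq> 0\<close> by (simp add: field_simps)
  then show ?thesis
    unfolding Rop_def Pop_def uop_def n_def[symmetric] s_def[symmetric] D
    by (simp add: linear_add[OF linear_step] linear_add[OF linear_step_inv]
        linear_scale[OF linear_step] algebra_simps)
qed

text \<open>The factor \<open>U + z\<close> for the \<open>n\<close>-th coin index kills the \<open>n\<close>-th coordinate of \<open>Rop d d f\<close>,
  because the coin sums vanish. All these factors together annihilate \<open>Rop d d f\<close>, and each is
  injective.\<close>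

lemma Rop_eq_0:
  assumes "f \<in> supported d"
  shows "Rop d d f = 0"
proof -
  \<comment> \<open>Induction on the number \<open>n\<close> of coordinates not yet known to vanish;
    for \<open>n = 2*d+1\<close> the hypothesis is just the support condition.\<close>
  have "Rop d d f = 0" if "n \<le> 2*d+1" "f \<in> supported d" "\<And>x j. n \<le> j \<Longrightarrow> coord (Rop d d f) (x, j) = 0" for n f
    using that
  proof (induction n arbitrary: f)
    case 0
    then show ?case
      by (intro ell2_eqI) (metis coord_simps(1) prod.collapse zero_le)
  next
    case (Suc n)
    define h where "h = step d f + translate (shift_of d n) f"
    have R: "alg d d (Rop d d)"
      by (rule alg_Rop) simp
    have h: "h \<in> supported d"
      unfolding h_def using Suc.prems
      by (intro subspace_add[OF subspace_supported] supported_step supported_translate shift_of_in_lat)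
    have Rh: "Rop d d h = step d (Rop d d f) + translate (shift_of d n) (Rop d d f)"
      unfolding h_def
      by (simp add: linear_add[OF alg_linear[OF R]] alg_step_commute[OF R] alg_translate_commute[OF R])
    have "coord (Rop d d h) (x, j) = 0" if "n \<le> j" for x j
    proof (cases "j < 2*d+1")
      case True
      then have "coord (Rop d d h) (x, j) = coord (Rop d d f) (\<lambda>i. x i - shift_of d n i, j)
          - coord (Rop d d f) (\<lambda>i. x i - shift_of d j i, j)"
        by (simp add: Rh coord_step coord_translate amp_sum_Rop)
      also have "\<dots> = 0"
        using Suc.prems(3)[of j] that by (cases "j = n") auto
      finally show ?thesis .
    next
      case False
      then show ?thesis
        using alg_supported[OF R _ h] by (auto simp: supported_def)
    qed
    then have "Rop d d h = 0"
      using Suc.IH h Suc.prems(1) by auto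
    then show ?case
      using step_plus_translate_inj[of "Rop d d f" d n] alg_supported[OF R _ Suc.prems(2)] Suc.prems(1)
      by (auto simp: Rh)
  qed
  from this[of "2*d+1" f] show ?thesis
    using assms alg_supported[OF alg_Rop[of d d d], of f] by (auto simp: supported_def)
qed

section \<open>Injective factors, kernel and adjoint of \<open>Qop\<close>\<close>

text \<open>Common form of two factorisations: b = (U + z) (1 + 1/(z U)) and u = (U + 1) (1 +
  1/U).\<close>

lemma step_plus_translate_inj_comp:
  assumes "f \<in> supported d" "i < 2*d+1" "k < 2*d+1"
    and "step d (f + translate (shift_of d i) (step_inv d f))
      + translate (shift_of d k) (f + translate (shift_of d i) (step_inv d f)) = 0"
  shows "f = 0"
proof -
  have *: "step_inv d f \<in> supported d"
    by (intro supported_step_inv assms)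
  have "f + translate (shift_of d i) (step_inv d f) = 0"
    by (rule step_plus_translate_inj[OF _ assms(3,4)])
      (intro subspace_add[OF subspace_supported] supported_translate shift_of_in_lat assms *)
  then have "step_inv d f = 0"
    by (intro step_plus_translate_inj[OF * assms(2)]) simp
  then show ?thesis
    by (metis linear_0[OF linear_step] step_step_inv(1))
qed

lemma bop_inj:
  assumes "f \<in> supported d" "i < d" "bop d i f = 0"
  shows "f = 0"
proof (rule step_plus_translate_inj_comp[of f d "d + 1 + i" i])
  show "step d (f + translate (shift_of d (d + 1 + i)) (step_inv d f))
      + translate (shift_of d i) (f + translate (shift_of d (d + 1 + i)) (step_inv d f)) = 0"
    using assms(3) unfolding shift_of_simps(1,3)[OF assms(2)] bop_def
    by (simp add: linear_add[OF linear_step] linear_add[OF linear_translate] step_translate algebra_simps)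
qed (use assms in auto)

lemma uop_inj:
  assumes "f \<in> supported d" "uop d f = 0"
  shows "f = 0"
proof (rule step_plus_translate_inj_comp[of f d d d])
  show "step d (f + translate (shift_of d d) (step_inv d f))
      + translate (shift_of d d) (f + translate (shift_of d d) (step_inv d f)) = 0"
    using assms(2) unfolding shift_of_simps(2) uop_def
    by (simp add: linear_add[OF linear_step] scaleR_2 algebra_simps)
qed (use assms in auto)

lemma Nop_inj:
  assumes "n \<le> d" "f \<in> supported d" "Nop d n f = 0"
  shows "f = 0"
  using assms
proof (induction n)
  case (Suc n)
  then show ?case
    using bop_inj[OF alg_supported[OF alg_Nop[of n d d]], of f n] by auto
qed simp

lemma Pop_Suc: "Pop d (Suc n) f = bop d n (Pop d n f) + 2 *\<^sub>R uop d (Nop d n f)"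
  using alg_linear[OF alg_uop[of d 0]] alg_linear[OF alg_bop[of n "Suc n" d]]
    alg_commute[OF alg_uop[of d 0] alg_bop[of n "Suc n" d]]
  by (simp add: Pop_def linear_add linear_scale algebra_simps)

text \<open>\<open>Qop d n f = 0\<close> gives \<open>Rop d n f\<close> the period 2 e_n, so it
  vanishes; that is, \<open>Pop d n h = 0\<close> for h = U f - f. \<open>Pop d n\<close> is not
  itself split into injective factors: instead, \<open>Rop d d f = 0\<close> reads b_n
  \<open>Pop d n h\<close> + 2 u N h = 0, which leaves u N h = 0, and u and N are injective.\<close>

lemma Qop_kernel:
  assumes "d = Suc n" "f \<in> supported d" "Qop d n f = 0"
  shows "step d f = f"
proof -
  define h where "h = step d f - f"
  have h: "h \<in> supported d"
    unfolding h_def using assms by (intro subspace_diff[OF subspace_supported] supported_step)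
  have P: "Pop d m h = Rop d m f" for m
    unfolding h_def Rop_def
    by (simp add: linear_diff[OF alg_linear[OF alg_Pop[of m m d]]] alg_step_commute[OF alg_Pop[of m m d]])
  have "Rop d n f = 0"
  proof (rule ell2_eqI)
    fix a :: "(nat \<Rightarrow> int) \<times> nat"
    have "coord (Rop d n f) (x, j) = 0" for x j
    proof (rule coord_eq_0_if_shifts_agree)
      show "unit_vec n \<noteq> (\<lambda>k. - unit_vec n k)"
        by (auto simp: fun_eq_iff unit_vec_def)
      show "coord (Rop d n f) (\<lambda>i. x i - unit_vec n i, j) = coord (Rop d n f) (\<lambda>i. x i - - unit_vec n i, j)" for x
        using arg_cong[OF assms(3), of "\<lambda>g. coord g (x, j)"] by (simp add: Qop_def coord_translate)
    qed
    then show "coord (Rop d n f) a = coord 0 a"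
      by (cases a) simp
  qed
  moreover have "Rop d d f = 0"
    by (rule Rop_eq_0) fact
  ultimately have "uop d (Nop d n h) = 0"
    using P[of n] P[of d] Pop_Suc[of d n h] assms(1)
      linear_0[OF alg_linear[OF alg_bop[of n "Suc n" d]]] by simp
  then have "Nop d n h = 0"
    using uop_inj alg_supported[OF alg_Nop[of n d d] _ h] assms(1) by simp
  then have "h = 0"
    using Nop_inj[of n d h] h assms(1) by simp
  then show ?thesis
    by (simp add: h_def)
qed

lemma inner_bop: "inner (bop d i f) g = inner f (bop d i g)"
  by (simp add: bop_def inner_add_left inner_add_right inner_step_adjoint inner_step_inv_adjoint
      inner_translate_adjoint)

lemma inner_uop: "inner (uop d f) g = inner f (uop d g)"
  by (simp add: uop_def inner_add_left inner_add_right inner_step_adjoint inner_step_inv_adjoint)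

lemma inner_Nop: "inner (Nop d n f) g = inner f (Nop d n g)"
proof (induction n arbitrary: f g)
  case (Suc n)
  then show ?case
    using alg_commute[OF alg_Nop[of n "Suc n" d] alg_bop[of n "Suc n" d], of g]
    by (simp add: inner_bop)
qed simp

lemma inner_Sop: "inner (Sop d n f) g = inner f (Sop d n g)"
proof (induction n arbitrary: f g)
  case (Suc n)
  then show ?case
    using alg_commute[OF alg_Sop[of n "Suc n" d] alg_bop[of n "Suc n" d], of g]
    by (simp add: inner_bop inner_add_left inner_add_right inner_Nop)
qed simp

lemma inner_Pop: "inner (Pop d n f) g = inner f (Pop d n g)"
  using alg_commute[OF alg_Sop[of n n d] alg_uop[of d n], of g]
  by (simp add: Pop_def inner_add_left inner_add_right inner_Nop inner_Sop inner_uop)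

text \<open>Q is (z - 1/z) (U - 1) \<open>Pop d n\<close> with a self-adjoint last factor. The
  adjoints of the other two are -(z - 1/z) and -(U - 1)/U; the signs cancel, so Q* = Q/U.\<close>

lemma inner_Qop: "inner (Qop d n f) g = inner f (step_inv d (Qop d n g))"
proof -
  define p where "p = Pop d n (fwd n g) - Pop d n (bwd n g)"
  have "Qop d n g = step d p - p"
    unfolding p_def Qop_def Rop_def
    by (simp add: linear_diff[OF linear_step] linear_diff[OF linear_translate] step_translate
        alg_translate_commute[OF alg_Pop[of n n d]])
  then have "inner f (step_inv d (Qop d n g)) = inner f p - inner f (step_inv d p)"
    by (simp add: linear_diff[OF linear_step_inv] inner_diff_right)
  also have "\<dots> = inner (Pop d n f) (fwd n g) - inner (Pop d n f) (bwd n g)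
      - inner (Pop d n (step d f)) (fwd n g) + inner (Pop d n (step d f)) (bwd n g)"
    by (simp add: p_def inner_diff_right inner_step_adjoint[symmetric] inner_Pop)
  also have "\<dots> = inner (Qop d n f) g"
    unfolding Qop_def Rop_def
    by (simp add: inner_diff_left inner_diff_right inner_translate_adjoint linear_diff[OF linear_translate]
        alg_step_commute[OF alg_Pop[of n n d]])
  finally show ?thesis ..
qed

section \<open>Decay by commutation with the position operator\<close>


definition position :: "nat \<Rightarrow> walk \<Rightarrow> walk \<Rightarrow> bool" where
  "position k f g \<longleftrightarrow> (\<forall>x j. coord g (x, j) = of_int (x k) * coord f (x, j))"

definition derivation :: "nat \<Rightarrow> (walk \<Rightarrow> walk) \<Rightarrow> (walk \<Rightarrow> walk) \<Rightarrow> bool" where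
  "derivation k A A' \<longleftrightarrow> (\<forall>f g. position k f g \<longrightarrow> position k (A f) (A g + A' f))"

text \<open>\<open>derivation k A A'\<close> says that \<open>A'\<close> is the commutator \<open>[X, A]\<close> on the domain of the unbounded
  operator \<open>X\<close> multiplying by the \<open>k\<close>-th position coordinate, whose graph is \<open>position k\<close>.
  \<open>accum d A n\<close> is the sum of \<open>U^j A U^(n-1-j)\<close> over \<open>j < n\<close>, which is \<open>[X, U^n]\<close> for
  \<open>A = [X, U]\<close> and \<open>n U^(n-1) A\<close> if \<open>A\<close> commutes with \<open>U\<close>.\<close>

primrec accum :: "nat \<Rightarrow> (walk \<Rightarrow> walk) \<Rightarrow> nat \<Rightarrow> walk \<Rightarrow> walk" where
  "accum d A 0 f = 0"
| "accum d A (Suc n) f = step d (accum d A n f) + A ((step d ^^ n) f)"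

text \<open>The bound may depend on the coordinate: X U^n f is controlled only pointwise, since the
  position enters as a factor.\<close>

definition coord_bounded :: "(nat \<Rightarrow> walk) \<Rightarrow> bool" where
  "coord_bounded h \<longleftrightarrow> (\<forall>a. \<exists>C. \<forall>n. cmod (coord (h n) a) \<le> C)"

lemma coord_bounded_diff:
  assumes "coord_bounded g" "coord_bounded h"
  shows "coord_bounded (\<lambda>n. g n - h n)"
  unfolding coord_bounded_def
proof
  fix a
  from assms obtain C D where "\<And>n. cmod (coord (g n) a) \<le> C" "\<And>n. cmod (coord (h n) a) \<le> D"
    unfolding coord_bounded_def by metis
  then have "cmod (coord (g n - h n) a) \<le> C + D" for n
    by (metis coord_simps(3) add_mono norm_triangle_ineq4 order_trans)
  then show "\<exists>C. \<forall>n. cmod (coord (g n - h n) a) \<le> C"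
    by blast
qed

lemma coord_bounded_scaleR:
  assumes "coord_bounded h"
  shows "coord_bounded (\<lambda>n. r *\<^sub>R h n)"
  unfolding coord_bounded_def
proof
  fix a
  from assms obtain C where "\<And>n. cmod (coord (h n) a) \<le> C"
    unfolding coord_bounded_def by metis
  then have "cmod (coord (r *\<^sub>R h n) a) \<le> \<bar>r\<bar> * C" for n
    by (simp add: norm_mult mult_left_mono)
  then show "\<exists>C. \<forall>n. cmod (coord (r *\<^sub>R h n) a) \<le> C"
    by blast
qed

lemma coord_bounded_0: "coord_bounded (\<lambda>n. 0)"
  by (auto simp: coord_bounded_def intro: exI[of _ 0])

lemma coord_bounded_uminus: "coord_bounded h \<Longrightarrow> coord_bounded (\<lambda>n. - h n)"
  using coord_bounded_scaleR[of h "-1"] by simp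

lemma coord_bounded_add: "coord_bounded g \<Longrightarrow> coord_bounded h \<Longrightarrow> coord_bounded (\<lambda>n. g n + h n)"
  using coord_bounded_diff[OF _ coord_bounded_uminus] by fastforce

lemma coord_bounded_reindex: "coord_bounded h \<Longrightarrow> coord_bounded (\<lambda>n. reindex p (h n))"
  by (cases "bij p") (auto simp: coord_bounded_def reindex.rep_eq simp del: split_paired_All)

lemma coord_bounded_sum:
  assumes "\<And>c. c \<in> A \<Longrightarrow> coord_bounded (h c)"
  shows "coord_bounded (\<lambda>n. \<Sum>c\<in>A. h c n)"
  using assms
  by (induction A rule: infinite_finite_induct) (simp_all add: coord_bounded_0 coord_bounded_add)

lemma coord_bounded_coin: "coord_bounded h \<Longrightarrow> coord_bounded (\<lambda>n. coin d (h n))"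
  unfolding coin_def coin_sum_def rot_def
  by (intro coord_bounded_diff coord_bounded_scaleR coord_bounded_sum coord_bounded_reindex)

lemma coord_bounded_alg: "alg d n A \<Longrightarrow> coord_bounded h \<Longrightarrow> coord_bounded (\<lambda>n. A (h n))"
proof (induction arbitrary: h rule: alg.induct)
  case step
  then show ?case
    unfolding step_def shift_def by (intro coord_bounded_reindex coord_bounded_coin)
next
  case step_inv
  then show ?case
    unfolding step_inv_def shift_inv_def by (intro coord_bounded_reindex coord_bounded_coin)
next
  case (fwd i)
  then show ?case
    unfolding translate_def by (intro coord_bounded_reindex)
next
  case (bwd i)
  then show ?case
    unfolding translate_def by (intro coord_bounded_reindex)
next
  case (add A B)
  then show ?case
    by (intro coord_bounded_add) blast+
next
  case (scale A r)
  then show ?case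
    by (intro coord_bounded_scaleR) blast
next
  case (comp A B)
  then show ?case
    by blast
qed

lift_definition mask :: "'a set \<Rightarrow> 'a ell2 \<Rightarrow> 'a ell2" is
  "\<lambda>A f a. if a \<in> A then f a else 0"
  by (rule summable_on_comparison_test) auto

text \<open>The displacement of the last step in direction \<open>k\<close>: [X, U] =
  \<open>kick d k\<close> U. Written with masks, it is visibly an operator on the whole space,
  although X is not.\<close>

definition kick :: "nat \<Rightarrow> nat \<Rightarrow> walk \<Rightarrow> walk" where
  "kick d k f = mask (UNIV \<times> {k}) f - mask (UNIV \<times> {d + 1 + k}) f"

lemma coord_kick:
  assumes "k < d"
  shows "coord (kick d k f) (x, j) = of_int (shift_of d j k) * coord f (x, j)"
  using assms by (auto simp: kick_def mask.rep_eq shift_of_def unit_vec_def)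

lemma position_step:
  assumes "k < d" "position k f g"
  shows "position k (step d f) (step d g + kick d k (step d f))"
proof -
  have "amp_sum d g x = of_int (x k) * amp_sum d f x" for x
    using assms(2) by (simp add: amp_sum_def position_def sum_distrib_left del: sum.lessThan_Suc)
  with assms show ?thesis
    by (auto simp: position_def coord_kick coord_step algebra_simps shift_of_def)
qed

lemma position_step_inv:
  assumes "k < d" "position k f g"
  shows "position k (step_inv d f) (step_inv d g - step_inv d (kick d k f))"
proof -
  have *: "coord (shift_inv d (g - kick d k f)) (x, j) = of_int (x k) * coord (shift_inv d f) (x, j)" for x j
    using assms by (simp add: position_def coord_shift_inv coord_kick algebra_simps)
  then have "amp_sum d (shift_inv d (g - kick d k f)) x = of_int (x k) * amp_sum d (shift_inv d f) x" for x
    by (simp add: amp_sum_def sum_distrib_left del: sum.lessThan_Suc)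
  with * have "position k (step_inv d f) (step_inv d (g - kick d k f))"
    by (auto simp: position_def step_inv_def coord_coin algebra_simps)
  then show ?thesis
    by (simp add: linear_diff[OF linear_step_inv])
qed

lemma position_translate:
  assumes "position k f g"
  shows "position k (translate v f) (translate v g + of_int (v k) *\<^sub>R translate v f)"
  using assms by (auto simp: position_def coord_translate algebra_simps)

lemma position_linear:
  "position k f g \<Longrightarrow> position k f' g' \<Longrightarrow> position k (f + f') (g + g')"
  "position k f g \<Longrightarrow> position k (r *\<^sub>R f) (r *\<^sub>R g)"
  "position k 0 0"
  by (auto simp: position_def algebra_simps)

lemma position_0_iff: "position k 0 g \<longleftrightarrow> g = 0"
  by (auto simp: position_def intro: ell2_eqI)

lemma position_step_funpow:
  assumes "k < d" "position k f g"
  shows "position k ((step d ^^ n) f) ((step d ^^ n) g + accum d (\<lambda>f. kick d k (step d f)) n f)"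
proof (induction n)
  case (Suc n)
  from position_step[OF assms(1) this] show ?case
    by (simp add: linear_add[OF linear_step] add_ac)
qed (use assms in simp)

lemma norm_step_funpow [simp]: "norm ((step d ^^ n) f) = norm f"
  by (induction n) simp_all

lemma linear_step_funpow: "linear (step d ^^ n)"
proof (induction n)
  case (Suc n)
  then show ?case
    using linear_compose[OF _ linear_step] by (simp add: o_def)
qed (simp add: linear_id[unfolded id_def] id_def)

lemma alg_step_funpow_commute: "alg d n A \<Longrightarrow> A ((step d ^^ m) f) = (step d ^^ m) (A f)"
  by (induction m) (simp_all add: alg_step_commute)

lemma accum_add: "accum d (\<lambda>f. A f + B f) n f = accum d A n f + accum d B n f"
  by (induction n) (simp_all add: linear_add[OF linear_step])

lemma accum_scaleR: "accum d (\<lambda>f. r *\<^sub>R A f) n f = r *\<^sub>R accum d A n f"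
  by (induction n) (simp_all add: linear_scale[OF linear_step] scaleR_add_right)

lemma accum_comp_left: "alg d m B \<Longrightarrow> accum d (\<lambda>f. B (A f)) n f = B (accum d A n f)"
  by (induction n) (simp_all add: linear_0[OF alg_linear] linear_add[OF alg_linear] alg_step_commute)

lemma accum_comp_right: "alg d m B \<Longrightarrow> accum d (\<lambda>f. A (B f)) n f = accum d A n (B f)"
  by (induction n) (simp_all add: alg_step_funpow_commute)

lemma accum_0: "accum d (\<lambda>f. 0) n f = 0"
  by (induction n) (simp_all add: linear_0[OF linear_step])

text \<open>The additional \<open>step d\<close> on the left avoids the exponent n - 1.\<close>

lemma accum_alg: "alg d m A \<Longrightarrow> step d (accum d A n f) = real n *\<^sub>R (step d ^^ n) (A f)"
proof (induction n)
  case 0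
  then show ?case
    by (simp add: linear_0[OF linear_step])
next
  case (Suc n)
  then show ?case
    by (simp add: linear_add[OF linear_step] linear_scale[OF linear_step]
        alg_step_funpow_commute algebra_simps)
qed

text \<open>The sum telescopes to [X, U^n] f = X U^n f - U^n g with g = X f; at position x this is
  at most |x_k| times the norm of f plus the norm of g.\<close>

lemma accum_kick_bounded:
  assumes "k < d" "position k f g"
  shows "coord_bounded (\<lambda>n. accum d (\<lambda>f. kick d k (step d f)) n f)"
  unfolding coord_bounded_def
proof
  fix a :: "(nat \<Rightarrow> int) \<times> nat"
  obtain x j where a: "a = (x, j)"
    by force
  have "cmod (coord (accum d (\<lambda>f. kick d k (step d f)) n f) a) \<le> cmod (of_int (x k)) * norm f + norm g" for n
  proof -
    have "coord (accum d (\<lambda>f. kick d k (step d f)) n f) a =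
        of_int (x k) * coord ((step d ^^ n) f) a - coord ((step d ^^ n) g) a"
      using position_step_funpow[OF assms, of n] by (simp add: position_def a algebra_simps)
    also have "cmod \<dots> \<le> cmod (of_int (x k)) * cmod (coord ((step d ^^ n) f) a)
        + cmod (coord ((step d ^^ n) g) a)"
      by (metis norm_triangle_ineq4 norm_mult)
    also have "\<dots> \<le> cmod (of_int (x k)) * norm f + norm g"
      using cmod_coord_le[of "(step d ^^ n) f" a] cmod_coord_le[of "(step d ^^ n) g" a]
      by (intro add_mono mult_left_mono) auto
    finally show ?thesis .
  qed
  then show "\<exists>C. \<forall>n. cmod (coord (accum d (\<lambda>f. kick d k (step d f)) n f) a) \<le> C"
    by blast
qed

text \<open>Leibniz rule: [X, A B] = A [X, B] + [X, A] B. Since A and B commute with U, they pass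
  through \<open>accum\<close>, and boundedness reduces to that for U itself. The bound is claimed
  on the domain of X, which B preserves.\<close>

lemma alg_derivation:
  assumes "alg d n A" "n \<le> k" "k < d"
  shows "\<exists>A'. derivation k A A' \<and>
    (\<forall>f g. position k f g \<longrightarrow> coord_bounded (\<lambda>m. accum d A' m f))"
  using assms
proof (induction rule: alg.induct)
  case ident
  show ?case
    by (intro exI[of _ "\<lambda>_. 0"]) (simp add: derivation_def accum_0 coord_bounded_0)
next
  case step
  then show ?case
    by (intro exI[of _ "\<lambda>f. kick d k (step d f)"])
      (auto simp: derivation_def intro: position_step accum_kick_bounded)
next
  case step_inv
  define A' where "A' f = (-1) *\<^sub>R step_inv d (kick d k f)" for f
  have "derivation k (step_inv d) A'"
    using position_step_inv[OF \<open>k < d\<close>] by (simp add: derivation_def A'_def)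
  moreover have "coord_bounded (\<lambda>m. accum d A' m f)" if "position k f g" for f g
  proof -
    have "accum d A' m f = (-1) *\<^sub>R step_inv d (accum d (\<lambda>f. kick d k (step d f)) m (step_inv d f))" for m
    proof -
      \<comment> \<open>[X, 1/U] = - (1/U) [X, U] (1/U), with \<open>step d\<close> and
        \<open>step_inv d\<close> inserted to expose [X, U].\<close>
      have "A' = (\<lambda>f. (-1) *\<^sub>R step_inv d ((\<lambda>f. kick d k (step d f)) (step_inv d f)))"
        by (rule ext) (simp add: A'_def)
      then show ?thesis
        by (simp only: accum_scaleR accum_comp_left[OF alg.step_inv[of d 0]]
            accum_comp_right[OF alg.step_inv[of d 0], of "\<lambda>f. kick d k (step d f)"])
    qed
    moreover have "coord_bounded (\<lambda>m. (-1) *\<^sub>R step_inv d (accum d (\<lambda>f. kick d k (step d f)) m (step_inv d f)))"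
      using position_step_inv[OF \<open>k < d\<close> that] \<open>k < d\<close>
      by (intro coord_bounded_scaleR coord_bounded_alg[OF alg.step_inv[of d 0]] accum_kick_bounded)
    ultimately show ?thesis
      by simp
  qed
  ultimately show ?case
    by blast
next
  case (fwd i)
  then have "unit_vec i k = 0"
    by (simp add: unit_vec_def)
  then show ?case
    using position_translate[of k _ _ "unit_vec i"]
    by (intro exI[of _ "\<lambda>_. 0"]) (simp add: derivation_def accum_0 coord_bounded_0)
next
  case (bwd i)
  then have "unit_vec i k = 0"
    by (simp add: unit_vec_def)
  then show ?case
    using position_translate[of k _ _ "\<lambda>k. - unit_vec i k"]
    by (intro exI[of _ "\<lambda>_. 0"]) (simp add: derivation_def accum_0 coord_bounded_0)
next
  case (add A B)
  then obtain A' B' where A: "derivation k A A'" "\<And>f g. position k f g \<Longrightarrow> coord_bounded (\<lambda>m. accum d A' m f)"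
    and B: "derivation k B B'" "\<And>f g. position k f g \<Longrightarrow> coord_bounded (\<lambda>m. accum d B' m f)"
    by blast
  have "position k (A f + B f) (A g + B g + (A' f + B' f))" if "position k f g" for f g
  proof -
    have "position k (A f + B f) ((A g + A' f) + (B g + B' f))"
      using A(1) B(1) that unfolding derivation_def by (intro position_linear(1)) auto
    then show ?thesis
      by (simp only: add_ac)
  qed
  then show ?case
    using A(2) B(2)
    by (intro exI[of _ "\<lambda>f. A' f + B' f"]) (auto simp: derivation_def accum_add intro: coord_bounded_add)
next
  case (scale A r)
  then obtain A' where A: "derivation k A A'" "\<And>f g. position k f g \<Longrightarrow> coord_bounded (\<lambda>m. accum d A' m f)"
    by blast
  have "position k (r *\<^sub>R A f) (r *\<^sub>R A g + r *\<^sub>R A' f)" if "position k f g" for f g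
    using A(1) that position_linear(2)[of k "A f" "A g + A' f" r]
    by (simp add: derivation_def scaleR_add_right)
  then show ?case
    using A(2)
    by (intro exI[of _ "\<lambda>f. r *\<^sub>R A' f"]) (auto simp: derivation_def accum_scaleR intro: coord_bounded_scaleR)
next
  case (comp A B)
  then obtain A' B' where A: "derivation k A A'" "\<And>f g. position k f g \<Longrightarrow> coord_bounded (\<lambda>m. accum d A' m f)"
    and B: "derivation k B B'" "\<And>f g. position k f g \<Longrightarrow> coord_bounded (\<lambda>m. accum d B' m f)"
    by blast
  have lin: "A (f + g) = A f + A g" for f g
    using alg_linear[OF comp.hyps(1)] by (rule linear_add)
  have "position k (A (B f)) (A (B g) + (A (B' f) + A' (B f)))" if "position k f g" for f g
    using A(1) B(1) that unfolding derivation_def by (metis lin add.assoc)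
  moreover have "coord_bounded (\<lambda>m. accum d (\<lambda>f. A (B' f) + A' (B f)) m f)" if "position k f g" for f g
  proof -
    have "position k (B f) (B g + B' f)"
      using B(1) that by (simp add: derivation_def)
    then show ?thesis
      unfolding accum_add accum_comp_left[OF comp.hyps(1)] accum_comp_right[OF comp.hyps(2), of A']
      using A(2) B(2)[OF that] by (intro coord_bounded_add coord_bounded_alg[OF comp.hyps(1)])
  qed
  ultimately show ?case
    by (intro exI[of _ "\<lambda>f. A (B' f) + A' (B f)"]) (auto simp: derivation_def)
qed

lemma supported_position: "position k f g \<Longrightarrow> f \<in> supported d \<Longrightarrow> g \<in> supported d"
  by (auto simp: position_def supported_def)

lemma Rop_Suc_split:
  "Rop d (Suc n) f = (step d (Rop d n f) + step_inv d (Rop d n f)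
      + 2 *\<^sub>R uop d (step d (Nop d n f) - Nop d n f))
    + fwd n (Rop d n f) + bwd n (Rop d n f)"
  unfolding Rop_def Pop_Suc bop_def uop_def
  by (simp add: linear_add[OF linear_step] linear_diff[OF linear_step] linear_scale[OF linear_step]
      linear_diff[OF linear_step_inv] linear_diff[OF linear_translate] step_translate algebra_simps)

text \<open>Commuting \<open>Rop d d = 0\<close> with \<open>X\<close> expresses \<open>Qop d n\<close> through commutators whose \<open>accum\<close> is
  coordinatewise bounded, since \<open>z_n\<close> enters \<open>Rop d d\<close> only through the summand \<open>z_n + 1 / z_n\<close>
  of \<open>b_n\<close>.\<close>

lemma Qop_decay:
  assumes d: "d = Suc n" and f: "f \<in> supported d" and pos: "position n f g"
  shows "(\<lambda>m. coord ((step d ^^ m) (Qop d n f)) a) \<longlonglongrightarrow> 0"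
proof -
  define Y where "Y f = step d (Rop d n f) + step_inv d (Rop d n f)
      + 2 *\<^sub>R uop d (step d (Nop d n f) - Nop d n f)" for f
  have algR: "alg d n (Rop d n)"
    by (rule alg_Rop) simp
  have algN: "alg d n (Nop d n)"
    by (rule alg_Nop) simp
  have "alg d n (\<lambda>f. step d (Nop d n f) - Nop d n f)"
    by (rule alg_diff[OF alg.comp[OF alg.step algN] algN])
  \<comment> \<open>\<open>Y\<close> collects the terms of \<open>Rop d d\<close> free of z_n, so
    the commutators with X are under control.\<close>
  then have algY: "alg d n Y"
    unfolding Y_def[abs_def]
    by (intro alg.add alg.comp[OF alg.step algR] alg.comp[OF alg.step_inv algR]
        alg.scale alg.comp[OF alg_uop])
  have nd: "n < d"
    using d by simp
  obtain R' where R': "derivation n (Rop d n) R'"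
      "\<And>f g. position n f g \<Longrightarrow> coord_bounded (\<lambda>m. accum d R' m f)"
    using alg_derivation[OF algR _ nd] by blast
  obtain Y' where Y': "derivation n Y Y'"
      "\<And>f g. position n f g \<Longrightarrow> coord_bounded (\<lambda>m. accum d Y' m f)"
    using alg_derivation[OF algY _ nd] by blast
  have Q: "Qop d n f = - (Y' f + (fwd n (R' f) + bwd n (R' f)))"
    if f: "f \<in> supported d" and pos: "position n f g" for f g
  proof -
    define h where "h = Rop d n g + R' f"
    have R0: "Y f + fwd n (Rop d n f) + bwd n (Rop d n f) = 0" if "f \<in> supported d" for f
      using Rop_eq_0[OF that] Rop_Suc_split[of d n f] d by (simp add: Y_def)
    have "position n (Rop d n f) h"
      using R'(1) pos by (simp add: derivation_def h_def)
    \<comment> \<open>[X, z] = z and [X, 1/z] = -1/z; together these two terms contribute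
      \<open>Qop d n f\<close>.\<close>
    from position_translate[OF this, of "unit_vec n"] position_translate[OF this, of "\<lambda>k. - unit_vec n k"]
    have "position n (fwd n (Rop d n f)) (fwd n h + fwd n (Rop d n f))"
      "position n (bwd n (Rop d n f)) (bwd n h - bwd n (Rop d n f))"
      by (simp_all add: unit_vec_def)
    moreover have "position n (Y f) (Y g + Y' f)"
      using Y'(1) pos by (simp add: derivation_def)
    ultimately have "position n (Y f + fwd n (Rop d n f) + bwd n (Rop d n f))
        ((Y g + Y' f) + (fwd n h + fwd n (Rop d n f)) + (bwd n h - bwd n (Rop d n f)))"
      by (intro position_linear(1))
    then have "(Y g + Y' f) + (fwd n h + fwd n (Rop d n f)) + (bwd n h - bwd n (Rop d n f)) = 0"
      by (simp add: R0[OF f] position_0_iff)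
    then have "(Y g + fwd n (Rop d n g) + bwd n (Rop d n g))
        + (Y' f + (fwd n (R' f) + bwd n (R' f)) + Qop d n f) = 0"
      by (simp add: h_def linear_add[OF linear_translate] Qop_def algebra_simps)
    then show ?thesis
      using R0[OF supported_position[OF pos f]] by (simp add: eq_neg_iff_add_eq_0 add.commute del: minus_add_distrib)
  qed
  \<comment> \<open>The formula \<open>Q\<close> holds only on the supported part of the domain of
    X, and every U^m f stays there.\<close>
  have accum: "accum d (Qop d n) m f = - (accum d Y' m f + (fwd n (accum d R' m f) + bwd n (accum d R' m f)))" for m
  proof (induction m)
    case 0
    then show ?case
      by (simp add: linear_0[OF linear_translate])
  next
    case (Suc m)
    have "(step d ^^ m) f \<in> supported d"
      using f by (induction m) (auto intro: supported_step)
    note q = Q[OF this position_step_funpow[OF nd pos]]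
    show ?case
      by (simp add: q Suc.IH linear_diff[OF linear_step] linear_add[OF linear_step] linear_add[OF linear_translate] step_translate
          linear_neg[OF linear_step] algebra_simps)
  qed
  have "coord_bounded (\<lambda>m. accum d (Qop d n) m f)"
    unfolding accum
    using R'(2)[OF pos] Y'(2)[OF pos]
    by (intro coord_bounded_uminus coord_bounded_add coord_bounded_alg[OF alg.fwd[of n "Suc n" d]]
        coord_bounded_alg[OF alg.bwd[of n "Suc n" d]]) auto
  then have "coord_bounded (\<lambda>m. step d (accum d (Qop d n) m f))"
    by (rule coord_bounded_alg[OF alg.step[of d 0]])
  then have "coord_bounded (\<lambda>m. real m *\<^sub>R (step d ^^ m) (Qop d n f))"
    by (simp add: accum_alg[OF alg_Qop[of n "Suc n" d]])
  then obtain C where C: "\<And>m. cmod (coord (real m *\<^sub>R (step d ^^ m) (Qop d n f)) a) \<le> C"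
    unfolding coord_bounded_def by metis
  show ?thesis
  proof (rule Lim_null_comparison)
    show "(\<lambda>m. C / real m) \<longlonglongrightarrow> 0"
      by (rule lim_const_over_n)
    show "\<forall>\<^sub>F m in sequentially. cmod (coord ((step d ^^ m) (Qop d n f)) a) \<le> C / real m"
      using eventually_gt_at_top[of "0::nat"]
    proof eventually_elim
      case (elim m)
      with C[of m] show ?case
        by (simp add: norm_mult field_simps)
    qed
  qed
qed

section \<open>Weak limits and eigenvalues\<close>


lemma bounded_linear_coord: "bounded_linear (\<lambda>f. coord f a)"
  by (rule bounded_linear_intro[where K = 1]) (simp_all add: scaleR_conv_of_real cmod_coord_le)

lemma closed_supported: "closed (supported d)"
proof -
  have "supported d = (\<Inter>a\<in>{(x, j). x \<notin> lat d \<or> 2*d+1 \<le> j}. {f. coord f a = 0})"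
    by (auto simp: supported_def)
  moreover have "closed {f. coord f a = 0}" for a :: "(nat \<Rightarrow> int) \<times> nat"
    by (intro closed_Collect_eq linear_continuous_on bounded_linear_coord continuous_intros)
  ultimately show ?thesis
    by (simp add: closed_INT)
qed

lemma subspace_closure:
  fixes S :: "'a :: real_normed_vector set"
  assumes "subspace S"
  shows "subspace (closure S)"
proof (rule subspaceI)
  show "0 \<in> closure S"
    using subspace_0[OF assms] closure_subset by blast
next
  fix x y assume "x \<in> closure S" "y \<in> closure S"
  then obtain f g where "\<And>n. f n \<in> S" "f \<longlonglongrightarrow> x" "\<And>n. g n \<in> S" "g \<longlonglongrightarrow> y"
    unfolding closure_sequential by blast
  then have "\<forall>n. f n + g n \<in> S" "(\<lambda>n. f n + g n) \<longlonglongrightarrow> x + y"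
    using subspace_add[OF assms] by (auto intro: tendsto_add)
  then show "x + y \<in> closure S"
    unfolding closure_sequential by (intro exI conjI)
next
  fix x and c :: real assume "x \<in> closure S"
  then obtain f where "\<And>n. f n \<in> S" "f \<longlonglongrightarrow> x"
    unfolding closure_sequential by blast
  then have "\<forall>n. c *\<^sub>R f n \<in> S" "(\<lambda>n. c *\<^sub>R f n) \<longlonglongrightarrow> c *\<^sub>R x"
    using subspace_scale[OF assms] by (auto intro: tendsto_scaleR)
  then show "c *\<^sub>R x \<in> closure S"
    unfolding closure_sequential by (intro exI conjI)
qed

lift_definition single :: "'a \<Rightarrow> complex \<Rightarrow> 'a ell2" is "\<lambda>a c b. if b = a then c else 0"
  by (rule finite_nonzero_values_imp_summable_on) (auto intro: finite_subset[of _ "{_}"])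

lemma inner_single: "inner f (single a c) = Re (coord f a * cnj c)"
proof -
  have "inner f (single a c) = (\<Sum>\<^sub>\<infinity>b\<in>{a}. Re (coord f b * cnj c))"
    unfolding inner_ell2_def by (rule infsum_cong_neutral) (auto simp: single.rep_eq)
  then show ?thesis
    by simp
qed

lemma eq_0_if_orthogonal_to_singles:
  assumes "f \<in> supported d"
    and "\<And>x j c. x \<in> lat d \<Longrightarrow> j < 2*d+1 \<Longrightarrow> inner f (single (x, j) c) = 0"
  shows "f = 0"
proof (rule ell2_eqI)
  fix a :: "(nat \<Rightarrow> int) \<times> nat"
  obtain x j where a: "a = (x, j)"
    by force
  show "coord f a = coord 0 a"
  proof (cases "x \<in> lat d \<and> j < 2*d+1")
    case True
    then have "Re (coord f a * cnj (coord f a)) = 0"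
      using assms(2)[of x j "coord f a"] by (simp add: inner_single a)
    then show ?thesis
      by (simp add: complex_eq_iff sum_squares_eq_zero_iff)
  next
    case False
    with assms(1) show ?thesis
      by (auto simp: supported_def a)
  qed
qed

lemma weak_limit_is_projection:
  assumes d: "d = Suc n" and f: "f \<in> supported d"
  shows "\<exists>s\<in>supported d. step d s = s \<and>
    (\<forall>e\<in>supported d. step d e = e \<longrightarrow> inner (f - s) e = 0) \<and>
    (\<forall>a. (\<lambda>m. coord ((step d ^^ m) f) a) \<longlonglongrightarrow> coord s a)"
proof -
  define V where "V = {h \<in> supported d. \<exists>g. position n h g}"
  have "subspace V"
    unfolding V_def
    by (intro subspaceI) (auto intro: position_linear subspace_0 subspace_add subspace_scale subspace_supported)
  note algQ = alg_Qop[of n d d]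
  have linQ: "linear (Qop d n)"
    using alg_linear algQ d by blast
  define K where "K = closure (Qop d n ` V)"
  have "subspace K"
    unfolding K_def using linQ \<open>subspace V\<close> by (intro subspace_closure linear_subspace_image)
  moreover have "closed K"
    by (simp add: K_def)
  ultimately obtain q where q: "q \<in> K" "\<And>k. k \<in> K \<Longrightarrow> inner (f - q) k = 0"
    by (metis projection_exists)
  define s where "s = f - q"
  have "Qop d n ` V \<subseteq> supported d"
    using alg_supported[OF algQ] d by (auto simp: V_def)
  then have "K \<subseteq> supported d"
    unfolding K_def by (intro closure_minimal closed_supported)
  with q f have s: "s \<in> supported d"
    unfolding s_def by (intro subspace_diff[OF subspace_supported]) auto
  \<comment> \<open>Point masses lie in the domain of X. Orthogonality of \<open>s\<close> to
    \<open>K\<close> therefore says that the adjoint of \<open>Qop d n\<close>, which is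
    \<open>Qop d n\<close> followed by \<open>step_inv d\<close>, annihilates
    \<open>s\<close>.\<close>
  have "step_inv d (Qop d n s) = 0"
  proof (rule eq_0_if_orthogonal_to_singles)
    show "step_inv d (Qop d n s) \<in> supported d"
      using alg_supported[OF algQ _ s] d by (intro supported_step_inv) auto
    fix x j and c :: complex
    assume "x \<in> lat d" "j < 2*d+1"
    then have "single (x, j) c \<in> supported d"
      by (auto simp: supported_def single.rep_eq)
    moreover have "position n (single (x, j) c) (single (x, j) (of_int (x n) * c))"
      by (simp add: position_def single.rep_eq)
    ultimately have "single (x, j) c \<in> V"
      unfolding V_def by blast
    then have "Qop d n (single (x, j) c) \<in> K"
      unfolding K_def by (intro subsetD[OF closure_subset] imageI)
    from q(2)[OF this] show "inner (step_inv d (Qop d n s)) (single (x, j) c) = 0"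
      by (subst inner_commute) (simp add: inner_Qop[symmetric] inner_commute[of _ s] s_def[symmetric])
  qed
  then have "Qop d n s = 0"
    by (metis linear_0[OF linear_step] step_step_inv(1))
  then have step_s: "step d s = s"
    using Qop_kernel[OF d s] by simp
  show ?thesis
  proof (rule bexI[OF _ s], intro conjI step_s ballI allI impI)
    fix e assume e: "e \<in> supported d" "step d e = e"
    \<comment> \<open>The factor U - 1 annihilates fixed vectors, so the adjoint of Q does too, and
      \<open>K\<close> is orthogonal to them.\<close>
    have "Rop d n e = 0"
      using alg_step_commute[OF alg_Pop[of n n d], of e] e by (simp add: Rop_def)
    then have "Qop d n e = 0"
      by (simp add: Qop_def linear_0[OF linear_translate])
    then have "inner (Qop d n h) e = 0" for h
      by (simp add: inner_Qop linear_0[OF linear_step_inv])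
    then have "Qop d n ` V \<subseteq> {k. inner k e = 0}"
      by auto
    moreover have "closed {k. inner k e = 0}"
      by (intro closed_Collect_eq continuous_intros)
    ultimately have "K \<subseteq> {k. inner k e = 0}"
      unfolding K_def by (rule closure_minimal)
    with q show "inner (f - s) e = 0"
      by (auto simp: s_def)
  next
    fix a
    \<comment> \<open>Decay is known on a dense subset of \<open>K\<close>. Powers of U are
      isometric, so the approximation error is uniform in \<open>m\<close>.\<close>
    have q0: "(\<lambda>m. coord ((step d ^^ m) q) a) \<longlonglongrightarrow> 0"
    proof (rule LIMSEQ_I)
      fix r :: real assume "r > 0"
      then have "r/2 > 0"
        by simp
      with q(1) obtain h where h: "h \<in> V" "dist (Qop d n h) q < r/2"
        unfolding K_def closure_approachable by blast
      then have "(\<lambda>m. coord ((step d ^^ m) (Qop d n h)) a) \<longlonglongrightarrow> 0"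
        unfolding V_def by (auto intro: Qop_decay[OF d])
      from LIMSEQ_D[OF this \<open>r/2 > 0\<close>] obtain M
        where M: "\<And>m. m \<ge> M \<Longrightarrow> cmod (coord ((step d ^^ m) (Qop d n h)) a) < r/2"
        by auto
      have "cmod (coord ((step d ^^ m) q) a) < r" if "m \<ge> M" for m
      proof -
        have "cmod (coord ((step d ^^ m) (q - Qop d n h)) a) \<le> norm (q - Qop d n h)"
          using cmod_coord_le[of "(step d ^^ m) (q - Qop d n h)" a] by simp
        also have "\<dots> < r/2"
          using h(2) by (simp add: dist_norm norm_minus_commute)
        finally have "cmod (coord ((step d ^^ m) (q - Qop d n h)) a) < r/2" .
        moreover have *: "coord ((step d ^^ m) q) a =
            coord ((step d ^^ m) (q - Qop d n h)) a + coord ((step d ^^ m) (Qop d n h)) a"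
          by (simp add: linear_diff[OF linear_step_funpow])
        ultimately show ?thesis
          unfolding * using M[OF that] norm_triangle_ineq[of "coord ((step d ^^ m) (q - Qop d n h)) a"
              "coord ((step d ^^ m) (Qop d n h)) a"] by linarith
      qed
      then show "\<exists>M. \<forall>m\<ge>M. norm (coord ((step d ^^ m) q) a - 0) < r"
        by auto
    qed
    have "(step d ^^ m) s = s" for m
      by (induction m) (simp_all add: step_s)
    moreover have "f = q + s"
      by (simp add: s_def)
    ultimately have "coord ((step d ^^ m) f) a = coord ((step d ^^ m) q) a + coord s a" for m
      by (simp add: linear_add[OF linear_step_funpow])
    then show "(\<lambda>m. coord ((step d ^^ m) f) a) \<longlonglongrightarrow> coord s a"
      using tendsto_add[OF q0 tendsto_const[of "coord s a"]] by simp
  qed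
qed

section \<open>Transfer to the functions in \<open>l2 d\<close>\<close>

lemma supported_outside:
  assumes "f \<in> supported d" "a \<notin> lat d \<times> {..<2*d+1}"
  shows "coord f a = 0"
  using assms by (cases a) (auto simp: supported_def not_less)

definition raw :: "walk \<Rightarrow> (nat \<Rightarrow> int) \<Rightarrow> nat \<Rightarrow> complex" where
  "raw f = (\<lambda>x j. coord f (x, j))"

lemma raw_eq_iff: "raw f = raw g \<longleftrightarrow> f = g"
  unfolding raw_def by (metis ell2_eqI surj_pair)

lemma l2_eq_raw: "l2 d = raw ` supported d"
proof (intro equalityI subsetI)
  fix \<psi> assume \<psi>: "\<psi> \<in> l2 d"
  define f where "f a = \<psi> (fst a) (snd a)" for a
  have "(\<lambda>a. (cmod (f a))\<^sup>2) summable_on lat d \<times> {..<2*d+1}"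
  proof (rule summable_on_SigmaI)
    show "((\<lambda>j. (cmod (f (x, j)))\<^sup>2) has_sum coinnorm2 (2*d+1) (\<psi> x)) {..<2*d+1}" for x
      by (simp add: has_sum_finite_iff coinnorm2_def f_def del: sum.lessThan_Suc)
    show "(\<lambda>x. coinnorm2 (2*d+1) (\<psi> x)) summable_on lat d"
      using \<psi> by (simp add: l2_def)
  qed simp
  moreover have "f a = 0" if "a \<notin> lat d \<times> {..<2*d+1}" for a
    using that \<psi> by (cases a) (auto simp: l2_def f_def not_less)
  ultimately have "(\<lambda>a. (cmod (f a))\<^sup>2) summable_on UNIV"
    by (subst summable_on_cong_neutral[of "lat d \<times> {..<2*d+1}" UNIV]) auto
  then have "coord (Ell2 f) = f"
    by (simp add: Ell2_inverse)
  then have "raw (Ell2 f) = \<psi>" "Ell2 f \<in> supported d"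
    using \<psi> by (auto simp: raw_def f_def supported_def l2_def)
  then show "\<psi> \<in> raw ` supported d"
    by blast
next
  fix \<psi> assume "\<psi> \<in> raw ` supported d"
  then obtain f where f: "f \<in> supported d" "\<psi> = raw f"
    by blast
  have "(\<lambda>a. (cmod (coord f a))\<^sup>2) summable_on lat d \<times> {..<2*d+1}"
    by (rule summable_on_subset_banach[OF square_summable_coord]) simp
  from summable_on_SigmaD[OF this]
  have "(\<lambda>x. coinnorm2 (2*d+1) (raw f x)) summable_on lat d"
    by (simp add: coinnorm2_def raw_def del: sum.lessThan_Suc)
  with f show "\<psi> \<in> l2 d"
    by (auto simp: l2_def supported_def raw_def)
qed

lemma U_lazy_raw:
  assumes "f \<in> supported d"
  shows "U_lazy d (raw f) = raw (step d f)"
proof (intro ext)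
  fix x j
  show "U_lazy d (raw f) x j = raw (step d f) x j"
  proof (cases "x \<in> lat d \<and> j < 2*d+1")
    case True
    then show ?thesis
      by (simp add: U_lazy_def raw_def grover_def coord_step amp_sum_def
          del: sum.lessThan_Suc of_nat_add of_nat_mult)
  next
    case False
    then show ?thesis
      using supported_outside[OF supported_step[OF assms], of "(x, j)"]
      by (auto simp: U_lazy_def raw_def)
  qed
qed

lemma supported_step_funpow: "f \<in> supported d \<Longrightarrow> (step d ^^ n) f \<in> supported d"
  by (induction n) (auto intro: supported_step)

lemma U_lazy_funpow_raw: "f \<in> supported d \<Longrightarrow> (U_lazy d ^^ n) (raw f) = raw ((step d ^^ n) f)"
  by (induction n) (simp_all add: U_lazy_raw supported_step_funpow)

lemma l2_inner_raw:
  assumes "f \<in> supported d"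
  shows "l2_inner d (raw f) (raw g) = (\<Sum>\<^sub>\<infinity>a. coord f a * cnj (coord g a))"
proof -
  have "(\<lambda>a. coord f a * cnj (coord g a)) summable_on lat d \<times> {..<2*d+1}"
    by (rule summable_on_subset_banach[OF summable_inner_ell2]) simp
  from infsum_Sigma_banach[OF this]
  have "l2_inner d (raw f) (raw g) = (\<Sum>\<^sub>\<infinity>a\<in>lat d \<times> {..<2*d+1}. coord f a * cnj (coord g a))"
    by (simp add: l2_inner_def raw_def del: sum.lessThan_Suc)
  also have "\<dots> = (\<Sum>\<^sub>\<infinity>a. coord f a * cnj (coord g a))"
    by (rule infsum_cong_neutral) (use supported_outside[OF assms] in auto)
  finally show ?thesis .
qed

lift_definition times_i :: "'a ell2 \<Rightarrow> 'a ell2" is "\<lambda>f a. \<i> * f a"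
  by (simp add: norm_mult)

lemma supported_times_i: "f \<in> supported d \<Longrightarrow> times_i f \<in> supported d"
  by (auto simp: supported_def times_i.rep_eq)

lemma step_cscale:
  assumes "\<And>a. coord g a = c * coord f a"
  shows "coord (step d g) a = c * coord (step d f) a"
proof -
  have "amp_sum d g x = c * amp_sum d f x" for x
    unfolding amp_sum_def assms by (simp only: sum_distrib_left)
  then show ?thesis
    by (cases a) (simp add: coord_step assms algebra_simps)
qed

lemma step_times_i: "step d (times_i f) = times_i (step d f)"
  by (rule ell2_eqI) (simp add: times_i.rep_eq step_cscale[of "times_i f" \<i> f])

text \<open>The real inner product against i g is the imaginary part of the complex inner product
  against g.\<close>

lemma l2_inner_raw_eq_0_iff:
  assumes "f \<in> supported d"
  shows "l2_inner d (raw f) (raw g) = 0 \<longleftrightarrow> inner f g = 0 \<and> inner f (times_i g) = 0"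
proof -
  have "inner f (times_i g) = Re (\<Sum>\<^sub>\<infinity>a. - \<i> * (coord f a * cnj (coord g a)))"
    by (simp add: inner_ell2_eq_Re times_i.rep_eq mult_ac)
  also have "\<dots> = Im (l2_inner d (raw f) (raw g))"
    unfolding l2_inner_raw[OF assms] infsum_cmult_right' by simp
  finally show ?thesis
    by (simp add: complex_eq_iff l2_inner_raw[OF assms] inner_ell2_eq_Re)
qed

lemma eigenspace1_eq_raw: "eigenspace1 d = raw ` {f \<in> supported d. step d f = f}"
  unfolding eigenspace1_def l2_eq_raw by (auto simp: U_lazy_raw raw_eq_iff)

text \<open>The eigenspace is stable under multiplication by i, so real orthogonality to it is
  complex orthogonality. For uniqueness, the difference of two candidates lies in the eigenspace and
  is orthogonal to itself.\<close>

lemma proj_plus_raw: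
  assumes f: "f \<in> supported d" and s: "s \<in> supported d" "step d s = s"
    and orth: "\<And>e. e \<in> supported d \<Longrightarrow> step d e = e \<Longrightarrow> inner (f - s) e = 0"
  shows "proj_plus d (raw f) = raw s"
proof -
  define P where "P p \<longleftrightarrow> p \<in> eigenspace1 d \<and>
    (\<forall>\<psi>\<in>eigenspace1 d. l2_inner d (\<lambda>x j. raw f x j - p x j) \<psi> = 0)" for p
  have diff: "(\<lambda>x j. raw f x j - raw p x j) = raw (f - p)" for p
    by (simp add: raw_def)
  have "P (raw s)"
    unfolding P_def eigenspace1_eq_raw
  proof (intro conjI ballI)
    fix \<psi> assume "\<psi> \<in> raw ` {f \<in> supported d. step d f = f}"
    then obtain e where "\<psi> = raw e" "e \<in> supported d" "step d e = e"
      by blast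
    then show "l2_inner d (\<lambda>x j. raw f x j - raw s x j) \<psi> = 0"
      unfolding diff using f s
      by (simp add: l2_inner_raw_eq_0_iff subspace_diff[OF subspace_supported] orth
          supported_times_i step_times_i)
  qed (use s in auto)
  moreover have "p = raw s" if "P p" for p
  proof -
    have "p \<in> raw ` {f \<in> supported d. step d f = f}"
      using that by (simp only: P_def eigenspace1_eq_raw)
    then obtain t where t: "p = raw t" "t \<in> supported d" "step d t = t"
      by blast
    have e: "s - t \<in> supported d" "step d (s - t) = s - t"
      using s t by (simp_all add: subspace_diff[OF subspace_supported] linear_diff[OF linear_step])
    then have "l2_inner d (raw (f - t)) (raw (s - t)) = 0"
      using that unfolding P_def eigenspace1_eq_raw t(1) diff by blast
    then have "inner (f - t) (s - t) = 0"
      using f t by (simp add: l2_inner_raw_eq_0_iff subspace_diff[OF subspace_supported])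
    then have "inner (s - t) (s - t) = 0"
      using orth[OF e] by (simp add: inner_diff_left)
    then show ?thesis
      by (simp add: t(1))
  qed
  ultimately show ?thesis
    unfolding proj_plus_def P_def[symmetric] by (rule the_equality)
qed

text \<open>Convergence of mu^m alone would allow |mu| < 1. Since U is isometric, |mu| = 1, so the
  limit L is nonzero and mu L = L forces mu = 1.\<close>

lemma eigenvalue_eq_1:
  assumes d: "d = Suc n" and mu: "is_eigenvalue d mu"
  shows "mu = 1"
proof -
  from mu obtain f where f: "f \<in> supported d" "raw f \<noteq> (\<lambda>_ _. 0)" "raw (step d f) = (\<lambda>x j. mu * raw f x j)"
    unfolding is_eigenvalue_def l2_eq_raw by (auto simp: U_lazy_raw)
  have step: "coord (step d f) a = mu * coord f a" for a
    using fun_cong[OF fun_cong[OF f(3)], of "fst a" "snd a"] by (simp add: raw_def)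
  obtain a where a: "coord f a \<noteq> 0"
    using f(2) by (auto simp: raw_def fun_eq_iff)
  then have "norm f \<noteq> 0"
    by (metis norm_eq_zero coord_simps(1))
  have "(norm (step d f))\<^sup>2 = (cmod mu)\<^sup>2 * (norm f)\<^sup>2"
    unfolding norm_ell2_square step norm_mult power_mult_distrib by (rule infsum_cmult_right')
  with \<open>norm f \<noteq> 0\<close> have "cmod mu = 1"
    using power2_eq_1_iff[of "cmod mu"] norm_ge_zero[of mu] by auto
  obtain s where s: "\<And>a. (\<lambda>m. coord ((step d ^^ m) f) a) \<longlonglongrightarrow> coord s a"
    using weak_limit_is_projection[OF d f(1)] by blast
  have pow: "coord ((step d ^^ m) f) a = mu ^ m * coord f a" for m
  proof (induction m arbitrary: a)
    case (Suc m)
    then show ?case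
      using step_cscale[of "(step d ^^ m) f" "mu ^ m" f] by (simp add: step)
  qed simp
  define L where "L = coord s a / coord f a"
  have L: "(\<lambda>m. mu ^ m) \<longlonglongrightarrow> L"
    using tendsto_divide[OF s[of a] tendsto_const[of "coord f a"]] a by (simp add: pow L_def)
  have "cmod L = 1"
    using tendsto_norm[OF L] \<open>cmod mu = 1\<close> by (simp add: norm_power LIMSEQ_const_iff)
  have "(\<lambda>m. mu ^ Suc m) \<longlonglongrightarrow> mu * L"
    using tendsto_mult[OF tendsto_const L] by simp
  moreover have "(\<lambda>m. mu ^ Suc m) \<longlonglongrightarrow> L"
    using L by (rule LIMSEQ_Suc)
  ultimately have "mu * L = L"
    by (rule LIMSEQ_unique)
  with \<open>cmod L = 1\<close> show ?thesis
    by auto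
qed

section \<open>A finitely supported eigenvector for the eigenvalue 1\<close>

definition unit_cube :: "nat \<Rightarrow> (nat \<Rightarrow> int) set" where
  "unit_cube d = {x. \<forall>i. (i \<in> {..<d} \<longrightarrow> x i \<in> {0, 1}) \<and> (i \<notin> {..<d} \<longrightarrow> x i = 0)}"

text \<open>In momentum space the eigenvector for the eigenvalue \<open>1\<close> has entries \<open>1 / (1 + 1 / z_j)\<close>;
  multiplying by the product of all \<open>1 + z_i\<close> clears denominators and gives a finitely supported
  state.\<close>

definition cube_state :: "nat \<Rightarrow> (nat \<Rightarrow> int) \<Rightarrow> nat \<Rightarrow> complex" where
  "cube_state d x j = (if x \<in> unit_cube d \<and> j < 2*d+1 then
      if j < d then of_bool (x j = 1) else if j = d then 1/2 else of_bool (x (j - d - 1) = 0)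
    else 0)"

lemma finite_unit_cube: "finite (unit_cube d)"
  unfolding unit_cube_def by (rule finite_set_of_finite_funs) simp_all

lemma unit_cube_lat: "x \<in> unit_cube d \<Longrightarrow> x \<in> lat d"
  by (auto simp: unit_cube_def lat_def)

lemma cube_state_in_l2: "cube_state d \<in> l2 d"
proof -
  have "(\<lambda>x. coinnorm2 (2*d+1) (cube_state d x)) summable_on lat d"
    by (rule finite_nonzero_values_imp_summable_on)
      (rule finite_subset[OF _ finite_unit_cube[of d]], auto simp: coinnorm2_def cube_state_def)
  then show ?thesis
    using unit_cube_lat[of _ d] by (auto simp: l2_def cube_state_def)
qed

text \<open>Opposite coin indices carry the indicators of complementary faces, so each pair sums to
  1 on the cube. The middle entry 1/2 makes 2/D times the sum the indicator of the cube.\<close>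

lemma sum_cube_state:
  "(\<Sum>j<2*d+1. cube_state d x j) = (if x \<in> unit_cube d then of_nat (2*d+1) / 2 else 0)"
proof (cases "x \<in> unit_cube d")
  case True
  have "cube_state d x i + cube_state d x (d + 1 + i) = 1" if "i < d" for i
  proof -
    have "x i = 0 \<or> x i = 1"
      using True that by (auto simp: unit_cube_def)
    then show ?thesis
      using True that by (auto simp: cube_state_def)
  qed
  then show ?thesis
    unfolding sum_coin_indices using True by (simp add: cube_state_def field_simps)
qed (simp add: cube_state_def)

lemma unit_cube_coord: "x \<in> unit_cube d \<Longrightarrow> x i = 0 \<or> x i = 1"
  by (cases "i < d") (auto simp: unit_cube_def)

lemma unit_cube_cong:
  assumes "i < d" "\<And>k. k \<noteq> i \<Longrightarrow> x k = y k" "x i \<in> {0, 1}" "y i \<in> {0, 1}"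
  shows "x \<in> unit_cube d \<longleftrightarrow> y \<in> unit_cube d"
proof -
  have "y \<in> unit_cube d" if "x \<in> unit_cube d" "\<And>k. k \<noteq> i \<Longrightarrow> x k = y k" "y i \<in> {0, 1}" for x y
    unfolding unit_cube_def
  proof (intro CollectI allI)
    fix k
    show "(k \<in> {..<d} \<longrightarrow> y k \<in> {0, 1}) \<and> (k \<notin> {..<d} \<longrightarrow> y k = 0)"
    proof (cases "k = i")
      case True
      then show ?thesis
        using that(3) assms(1) by auto
    next
      case False
      then show ?thesis
        using that(1) unfolding unit_cube_def that(2)[OF False, symmetric] by blast
    qed
  qed
  from this[of x y] this[of y x] show ?thesis
    using assms by metis
qed

text \<open>The coin turns the indicator of a face into that of the opposite face, and the shift
  carries it back to the original face. The unshifted entry is fixed because 1 - 1/2 = 1/2.\<close>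

lemma U_lazy_cube_state: "U_lazy d (cube_state d) = cube_state d"
proof (intro ext)
  fix x j
  define y where "y k = x k - shift_of d j k" for k
  have D: "complex_of_nat (2*d+1) \<noteq> 0"
    by (metis add_is_0 of_nat_eq_0_iff one_neq_zero)
  show "U_lazy d (cube_state d) x j = cube_state d x j"
  proof (cases "x \<in> lat d \<and> j < 2*d+1")
    case True
    have "U_lazy d (cube_state d) x j = of_bool (y \<in> unit_cube d) - cube_state d y j"
      using True D unfolding U_lazy_def grover_def sum_cube_state y_def[abs_def, symmetric]
      by (simp del: of_nat_add of_nat_mult of_nat_Suc)
    also have "\<dots> = cube_state d x j"
    proof -
      consider "j < d" | "j = d" | "d < j"
        by linarith
      then show ?thesis
      proof cases
        case 1
        have y: "y k = x k - unit_vec j k" for k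
          using 1 by (simp add: y_def shift_of_simps)
        show ?thesis
        proof (cases "x j = 1")
          case True
          then have "x \<in> unit_cube d \<longleftrightarrow> y \<in> unit_cube d"
            using 1 by (intro unit_cube_cong[of j]) (auto simp: y unit_vec_def)
          with True 1 show ?thesis
            by (simp add: cube_state_def y unit_vec_def)
        next
          case False
          with 1 unit_cube_coord[of y d j] show ?thesis
            by (auto simp: cube_state_def y unit_vec_def)
        qed
      next
        case 2
        then have "y = x"
          by (simp add: y_def[abs_def] shift_of_simps)
        with 2 show ?thesis
          by (simp add: cube_state_def)
      next
        case j: 3
        define i where "i = j - d - 1"
        have 3: "i < d" "j = d + 1 + i"
          using j True by (auto simp: i_def)
        have y: "y k = x k + unit_vec i k" for k
          unfolding y_def 3(2) shift_of_simps(3)[OF 3(1)] by simp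
        show ?thesis
        proof (cases "x i = 0")
          case True
          then have "x \<in> unit_cube d \<longleftrightarrow> y \<in> unit_cube d"
            using 3 by (intro unit_cube_cong[of i]) (auto simp: y unit_vec_def)
          with True 3 show ?thesis
            by (simp add: cube_state_def y unit_vec_def)
        next
          case False
          with 3 unit_cube_coord[of y d i] show ?thesis
            by (auto simp: cube_state_def y unit_vec_def)
        qed
      qed
    qed
    finally show ?thesis .
  next
    case False
    then show ?thesis
      using unit_cube_lat[of x d] by (auto simp: U_lazy_def cube_state_def)
  qed
qed

lemma is_eigenvalue_1: "is_eigenvalue d 1"
proof -
  have "cube_state d (\<lambda>_. 0) d \<noteq> 0"
    by (simp add: cube_state_def unit_cube_def)
  then have "cube_state d \<noteq> (\<lambda>_ _. 0)"
    by (metis (no_types))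
  then show ?thesis
    unfolding is_eigenvalue_def using cube_state_in_l2 U_lazy_cube_state
    by (intro bexI[of _ "cube_state d"]) auto
qed

theorem mainTheorem3:
  fixes d :: nat
  assumes "d \<ge> 1"
  shows "is_eigenvalue d 1
    \<and> (\<forall>mu. is_eigenvalue d mu \<longrightarrow> mu = 1)
    \<and> (\<forall>\<phi> x. (\<forall>j\<ge>2*d+1. \<phi> j = 0) \<longrightarrow> x \<in> lat d \<longrightarrow>
         (\<lambda>n. p_n d n \<phi> x) \<longlonglongrightarrow> coinnorm2 (2*d+1) (proj_plus d (delta0 \<phi>) x))"
proof (intro conjI allI impI)
  \<comment> \<open>\<open>n\<close> is the last direction, whose position coordinate drives the
    decay; it exists because \<open>d \<ge> 1\<close>.\<close>
  obtain n where d: "d = Suc n"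
    using assms by (cases d) auto
  show "is_eigenvalue d 1"
    by (rule is_eigenvalue_1)
  show "mu = 1" if "is_eigenvalue d mu" for mu
    using eigenvalue_eq_1[OF d that] .
  fix \<phi> :: "nat \<Rightarrow> complex" and x :: "nat \<Rightarrow> int"
  assume \<phi>: "\<forall>j\<ge>2*d+1. \<phi> j = 0"
  have "(\<lambda>x. coinnorm2 (2*d+1) (delta0 \<phi> x)) summable_on lat d"
    by (rule finite_nonzero_values_imp_summable_on)
      (rule finite_subset[of _ "{\<lambda>_. 0}"], auto simp: coinnorm2_def delta0_def)
  then have "delta0 \<phi> \<in> l2 d"
    using \<phi> by (auto simp: l2_def delta0_def lat_def)
  then obtain f where f: "f \<in> supported d" "delta0 \<phi> = raw f"
    unfolding l2_eq_raw by blast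
  obtain s where s: "s \<in> supported d" "step d s = s"
    "\<And>e. e \<in> supported d \<Longrightarrow> step d e = e \<Longrightarrow> inner (f - s) e = 0"
    "\<And>a. (\<lambda>m. coord ((step d ^^ m) f) a) \<longlonglongrightarrow> coord s a"
    using weak_limit_is_projection[OF d f(1)] by blast
  \<comment> \<open>Only finitely many coordinates sit over a fixed \<open>x\<close>, so
    coordinatewise convergence suffices.\<close>
  have "(\<lambda>n. coinnorm2 (2*d+1) (raw ((step d ^^ n) f) x)) \<longlonglongrightarrow> coinnorm2 (2*d+1) (raw s x)"
    unfolding coinnorm2_def raw_def by (intro tendsto_intros s(4))
  then show "(\<lambda>n. p_n d n \<phi> x) \<longlonglongrightarrow> coinnorm2 (2*d+1) (proj_plus d (delta0 \<phi>) x)"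
    by (simp add: p_n_def f U_lazy_funpow_raw proj_plus_raw[OF f(1) s(1-3)])
qed

end
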